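(* Suppose that the discrete-time robust control contraction metric condition (RCCM) holds with $M,K,\rho_c,\alpha_1,\alpha_2$, and that the proportional error bound (PEB) is valid with constants $c_x,c_u$. Consider an initial state $x(0)\in\mathbb R^{n_x}$ and sequences $\bar x_k\in\mathbb R^{n_x}$, $\bar u_k\in\mathbb R^{n_u}$, $\delta_k\in\mathbb R$, $k=0,1,\dots$, satisfying for all $k\ge0$ $$h_j(\bar x_k,\bar u_k)+c_j\delta_k\le0\quad\forall j\in\{1,\dots,n_h\},\qquad \bar x_{k+1}=\hat F(\bar x_k,\bar u_k),$$ $$V(x(0),\bar x_0)\le\delta_0,\qquad \delta_{k+1}=\sqrt{1-\rho_c}\,\delta_k+\sqrt{\alpha_2}\,\big(c_x\|\hat\Phi(\bar x_k)\|+c_u\|\bar u_k\|\big),$$ where $$c_j=\max_{(x,u)\in\mathcal Z}\left\|\left(\frac{\partial h_j}{\partial x}(x,u)+\frac{\partial h_j}{\partial u}(x,u)K(x)\right)M(x)^{-1/2}\right\|.$$ Then, for any $k\in\{0,1,\dots\}$, the true trajectory $x(k+1)=F(x(k),\kappa(x(k),\bar x_k,\bar u_k))$ satisfies $$V(x(k),\bar x_k)\le\delta_k\qquad\text{and}\qquad (x(k),\kappa(x(k),\bar x_k,\bar u_k))\in\mathcal Z.$$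
   Context: Notation: $\|\cdot\|$ is the Euclidean norm, $\|y\|_P=\sqrt{y^\top P y}$, $\mathcal B(y,r)$ is the closed ball, $\otimes$ the Kronecker product, $\preceq$ the Loewner order, $\mathbb S_+^n$ the symmetric positive definite $n\times n$ matrices, $\|\cdot\|_F$ the Frobenius norm; $P^{1/2}$ is the Cholesky factor with $P=(P^{1/2})^\top P^{1/2}$ and $P^{-1/2}$ its inverse. System. $\mathbb X\subset\mathbb R^{n_x}$ and $\mathbb U\subset\mathbb R^{n_u}$ are compact, and $\mathbb U$ contains the standard basis vectors $e_1,\dots,e_{n_u}$. The true system is $\dot x=f(x)+g(x)u$ with $f(0)=0$; $x(t;\hat x,u)$ is its solution at time $t$ from $\hat x$ under constant input $u$ (provided it exists), $T_s>0$ is fixed, and $F(x,u)=x(T_s;x,u)$ is the sampled true map. The constraint set $\mathcal Z=\{(x,u)\in\mathbb R^{n_x}\times\mathbb R^{n_u}\mid h_j(x,u)\le0,\ j=1,\dots,n_h\}\subseteq\mathbb X\times\mathbb U$ is compact, each $h_j$ is continuously differentiable and $h_j(0,0)<0$. Learned model. $\hat\Phi(x)=[x^\top\ \phi_{n_x+1}(x)\cdots\phi_{n_z}(x)]^\top\in\mathbb R^{n_z}$, $n_z>n_x$, with continuously differentiable $\phi_\ell:\mathbb R^{n_x}\to\mathbb R$, $\phi_\ell(0)=0$. From data $y_j^{\tilde u}=F(x_j^{\tilde u},\tilde u)$, $j=1,\dots,d$, $\tilde u\in\{0,e_1,\dots,e_{n_u}\}$, the matrices $A,B_i\in\mathbb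 R^{n_z\times n_z}$ and $b_i\in\mathbb R^{n_z}$ are least-squares fits: $A$ minimizes $\|[\hat\Phi(y_1^0)\cdots\hat\Phi(y_d^0)]-A[\hat\Phi(x_1^0)\cdots\hat\Phi(x_d^0)]\|_F$, and $[b_i\ B_i]$ minimizes $\|[\hat\Phi(y_1^{e_i})\cdots\hat\Phi(y_d^{e_i})]-[b_i\ B_i][\Phi(x_1^{e_i})\cdots\Phi(x_d^{e_i})]\|_F$ with $\Phi=[1\ \hat\Phi^\top]^\top$. Put $B_0=[b_1\cdots b_{n_u}]$, $\mathcal L(x,u)=A\hat\Phi(x)+B_0u+\sum_{i=1}^{n_u}(B_i-A)u_i\hat\Phi(x)$, $\xi(x,u)=\hat\Phi(F(x,u))-\mathcal L(x,u)$, and $\hat F(x,u)=[I_{n_x}\ 0_{n_x\times(n_z-n_x)}]\,\mathcal L(x,u)$. (PEB) with constants $c_x,c_u\ge0$: $\|\xi(x,u)\|\le c_x\|\hat\Phi(x)\|+c_u\|u\|$ for all $x\in\mathbb X$, $u\in\mathbb U$. Uncertain predictor. $E(x,u)=[c_x(\hat\Phi(x)^\top\otimes I_{n_x})\ \ c_u(u^\top\otimes I_{n_x})]$; $\mathbb D$ is the set of vectors $\begin{bmatrix}w_\Phi\otimes w_x\\ w_u\otimes w_x\end{bmatrix}$ with $w_\Phi\in\mathcal B(0_{n_z},1)$, $w_u\in\mathcal B(0_{n_u},1)$, $w_x\in\mathcal B(0_{n_x},1)$; and $f_w(x,u,w)=\hat F(x,u)+E(x,u)w$. (RCCM): $M:\mathbb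 R^{n_x}\to\mathbb S_+^{n_x}$ is continuously differentiable, $K:\mathbb R^{n_x}\to\mathbb R^{n_u\times n_x}$ is continuous, $0<\rho_c<1$, $\alpha_1,\alpha_2>0$, and for all $(x,u)\in\mathcal Z$, $w\in\mathbb D$, with $x_+=f_w(x,u,w)$ and $A_{cl}(x,u,w)=\frac{\partial f_w}{\partial x}(x,u,w)+\frac{\partial f_w}{\partial u}(x,u,w)K(x)$: $A_{cl}^\top M(x_+)A_{cl}\preceq(1-\rho_c)M(x)$, $\alpha_1I\preceq M(x)\preceq\alpha_2I$, and $M(x_+)\preceq\alpha_2I$. Distance and feedback. $\Gamma(\bar x,x)$ is the set of componentwise continuously differentiable curves $\gamma:[0,1]\to\mathbb R^{n_x}$ with $\gamma(0)=\bar x$, $\gamma(1)=x$. $V(x,\bar x)=\min_{\gamma\in\Gamma(\bar x,x)}\int_0^1\|\dot\gamma(s)\|_{M(\gamma(s))}ds$ is the Riemannian distance, $\gamma^*$ denotes a minimizer (geodesic, taken to exist). $\gamma^u(s)=\bar u+\int_0^sK(\gamma^*(s'))\dot\gamma^*(s')ds'$ and $\kappa(x,\bar x,\bar u)=\gamma^u(1)$.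
   Formalization: Added assumption: whenever c_j = 0 and h_j(x̄_k, ū_k) = 0 for some j, k, the row ∂h_j/∂x + (∂h_j/∂u)K(x) vanishes on an open neighbourhood of Z; without it the claim fails, e.g. when the nominal point is an isolated point of Z. *)

theory Defs
  imports "HOL-Analysis.Analysis"
begin

text \<open>
  Block structure is carried by index types: a sum type indexes a concatenation of two blocks and
  a product type indexes a Kronecker product.  With the lifted state indexed by
  \<^typ>\<open>'nx + 'nr\<close>, where \<^typ>\<open>'nr\<close> is a nonempty finite type, the lifted dimension exceeds the state
  dimension.
\<close>

(* Unlike real^'n, these do not fix the sort of the index variables to finite, so that an index type
   may also be linearly ordered.  In rmat the first argument indexes the rows. *)
type_synonym 'n rvec = "real^'n"
type_synonym ('m, 'n) rmat = "real^'n^'m"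

definition vcat :: "real^'m \<Rightarrow> real^'n \<Rightarrow> real^('m + 'n)" where
  "vcat v w = (\<chi> i. case i of Inl a \<Rightarrow> v $ a | Inr b \<Rightarrow> w $ b)"

definition hcat :: "real^'m^'r \<Rightarrow> real^'n^'r \<Rightarrow> real^('m + 'n)^'r" where
  "hcat P Q = (\<chi> r. vcat (P $ r) (Q $ r))"

definition from_cols :: "('d \<Rightarrow> real^'r) \<Rightarrow> real^'d^'r" where
  "from_cols v = (\<chi> r j. v j $ r)"

definition vkron :: "real^'m \<Rightarrow> real^'n \<Rightarrow> real^('m \<times> 'n)" where
  "vkron v w = (\<chi> p. v $ fst p * w $ snd p)"

(* The Kronecker product of the row vector v\<^sup>T with the matrix P; the single row index of v\<^sup>T is
   dropped. *)
definition row_kron :: "real^'m \<Rightarrow> real^'n^'r \<Rightarrow> real^('m \<times> 'n)^'r" where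
  "row_kron v P = (\<chi> r p. v $ fst p * P $ r $ snd p)"

definition psd :: "real^'n^'n \<Rightarrow> bool" where
  "psd P \<longleftrightarrow> transpose P = P \<and> (\<forall>v. 0 \<le> v \<bullet> (P *v v))"

definition spd :: "real^'n^'n \<Rightarrow> bool" where
  "spd P \<longleftrightarrow> transpose P = P \<and> (\<forall>v. v \<noteq> 0 \<longrightarrow> 0 < v \<bullet> (P *v v))"

definition loewner_le :: "real^'n^'n \<Rightarrow> real^'n^'n \<Rightarrow> bool" (infix "\<preceq>\<^sub>L" 50) where
  "P \<preceq>\<^sub>L Q \<longleftrightarrow> psd (Q - P)"

definition wnorm :: "real^'n^'n \<Rightarrow> real^'n \<Rightarrow> real" where
  "wnorm P y = sqrt (y \<bullet> (P *v y))"

(* For symmetric positive definite P there is exactly one such R, so the choice is immaterial. *)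
definition cholesky :: "(('n::{finite,linorder}), 'n) rmat \<Rightarrow> ('n, 'n) rmat" where
  "cholesky P = (SOME R. (\<forall>i j. j < i \<longrightarrow> R $ i $ j = 0) \<and> (\<forall>i. 0 < R $ i $ i) \<and>
                         transpose R ** R = P)"

definition cont_diff :: "('a::real_normed_vector \<Rightarrow> 'b::real_normed_vector) \<Rightarrow> bool" where
  "cont_diff f \<longleftrightarrow> (\<exists>f' :: 'a \<Rightarrow> 'a \<Rightarrow>\<^sub>L 'b.
      (\<forall>x. (f has_derivative blinfun_apply (f' x)) (at x)) \<and> continuous_on UNIV f')"

(* The derivative of a scalar function as a row vector; it is multiplied by matrices with v*. *)
definition row_deriv :: "(real^'n \<Rightarrow> real) \<Rightarrow> real^'n \<Rightarrow> real^'n" where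
  "row_deriv f x = (\<chi> i. frechet_derivative f (at x) (axis i 1))"

definition is_max :: "real \<Rightarrow> real set \<Rightarrow> bool" where
  "is_max m S \<longleftrightarrow> m \<in> S \<and> (\<forall>s\<in>S. s \<le> m)"

definition ode_solution ::
  "(real^'nx \<Rightarrow> real^'nx) \<Rightarrow> (real^'nx \<Rightarrow> real^'nu^'nx) \<Rightarrow> real \<Rightarrow> real^'nx \<Rightarrow> real^'nu
    \<Rightarrow> (real \<Rightarrow> real^'nx) \<Rightarrow> bool" where
  "ode_solution f g T xh u y \<longleftrightarrow> y 0 = xh \<and>
     (\<forall>t\<in>{0..T}. (y has_vector_derivative f (y t) + g (y t) *v u) (at t within {0..T}))"

(* Unspecified where no solution exists up to time t, or where its value at t is not unique. *)
definition flow ::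
  "(real^'nx \<Rightarrow> real^'nx) \<Rightarrow> (real^'nx \<Rightarrow> real^'nu^'nx) \<Rightarrow> real \<Rightarrow> real^'nx \<Rightarrow> real^'nu
    \<Rightarrow> real^'nx" where
  "flow f g t xh u = (THE z. \<exists>y. ode_solution f g t xh u y \<and> y t = z)"

definition constraint_set :: "('nh \<Rightarrow> real^'nx \<Rightarrow> real^'nu \<Rightarrow> real) \<Rightarrow> ((real^'nx) \<times> (real^'nu)) set" where
  "constraint_set h = {(x, u). \<forall>j. h j x u \<le> 0}"

definition lift_hat :: "('nr::finite \<Rightarrow> real^'nx \<Rightarrow> real) \<Rightarrow> real^'nx \<Rightarrow> real^('nx + 'nr)" where
  "lift_hat \<phi> x = vcat x (\<chi> l. \<phi> l x)"

definition lift_one :: "('nr::finite \<Rightarrow> real^'nx \<Rightarrow> real) \<Rightarrow> real^'nx \<Rightarrow> real^(1 + ('nx + 'nr))" where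
  "lift_one \<phi> x = vcat (vec 1) (lift_hat \<phi> x)"

(* The library norm of a matrix in real^'n^'m is the Frobenius norm. *)
definition least_squares :: "real^'d^'r \<Rightarrow> real^'d^'c \<Rightarrow> real^'c^'r \<Rightarrow> bool" where
  "least_squares Y X P \<longleftrightarrow> (\<forall>Q. norm (Y - P ** X) \<le> norm (Y - Q ** X))"

definition lifted_model ::
  "('nr::finite \<Rightarrow> real^'nx \<Rightarrow> real) \<Rightarrow> real^('nx + 'nr)^('nx + 'nr) \<Rightarrow> ('nu \<Rightarrow> real^('nx + 'nr))
    \<Rightarrow> ('nu \<Rightarrow> real^('nx + 'nr)^('nx + 'nr)) \<Rightarrow> real^'nx \<Rightarrow> real^'nu \<Rightarrow> real^('nx + 'nr)" where
  "lifted_model \<phi> A b B x u =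
     A *v lift_hat \<phi> x + from_cols b *v u + (\<Sum>i\<in>UNIV. (u $ i) *\<^sub>R ((B i - A) *v lift_hat \<phi> x))"

definition model_error ::
  "(real^'nx \<Rightarrow> real^'nu \<Rightarrow> real^'nx) \<Rightarrow> ('nr::finite \<Rightarrow> real^'nx \<Rightarrow> real) \<Rightarrow> real^('nx + 'nr)^('nx + 'nr)
    \<Rightarrow> ('nu \<Rightarrow> real^('nx + 'nr)) \<Rightarrow> ('nu \<Rightarrow> real^('nx + 'nr)^('nx + 'nr))
    \<Rightarrow> real^'nx \<Rightarrow> real^'nu \<Rightarrow> real^('nx + 'nr)" where
  "model_error F \<phi> A b B x u = lift_hat \<phi> (F x u) - lifted_model \<phi> A b B x u"

definition F_hat ::
  "('nr::finite \<Rightarrow> real^'nx \<Rightarrow> real) \<Rightarrow> real^('nx + 'nr)^('nx + 'nr) \<Rightarrow> ('nu \<Rightarrow> real^('nx + 'nr))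
    \<Rightarrow> ('nu \<Rightarrow> real^('nx + 'nr)^('nx + 'nr)) \<Rightarrow> real^'nx \<Rightarrow> real^'nu \<Rightarrow> real^'nx" where
  "F_hat \<phi> A b B x u = hcat (mat 1) 0 *v lifted_model \<phi> A b B x u"

definition PEB ::
  "(real^'nx) set \<Rightarrow> (real^'nu) set \<Rightarrow> (real^'nx \<Rightarrow> real^'nu \<Rightarrow> real^'nx)
    \<Rightarrow> ('nr::finite \<Rightarrow> real^'nx \<Rightarrow> real) \<Rightarrow> real^('nx + 'nr)^('nx + 'nr) \<Rightarrow> ('nu \<Rightarrow> real^('nx + 'nr))
    \<Rightarrow> ('nu \<Rightarrow> real^('nx + 'nr)^('nx + 'nr)) \<Rightarrow> real \<Rightarrow> real \<Rightarrow> bool" where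
  "PEB X U F \<phi> A b B c\<^sub>x c\<^sub>u \<longleftrightarrow> 0 \<le> c\<^sub>x \<and> 0 \<le> c\<^sub>u \<and>
     (\<forall>x\<in>X. \<forall>u\<in>U. norm (model_error F \<phi> A b B x u) \<le> c\<^sub>x * norm (lift_hat \<phi> x) + c\<^sub>u * norm u)"

definition E_mat ::
  "('nr::finite \<Rightarrow> real^'nx \<Rightarrow> real) \<Rightarrow> real \<Rightarrow> real \<Rightarrow> real^'nx \<Rightarrow> real^'nu
    \<Rightarrow> real^((('nx + 'nr) \<times> 'nx) + ('nu \<times> 'nx))^'nx" where
  "E_mat \<phi> c\<^sub>x c\<^sub>u x u =
     hcat (c\<^sub>x *\<^sub>R row_kron (lift_hat \<phi> x) (mat 1)) (c\<^sub>u *\<^sub>R row_kron u (mat 1))"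

definition disturbance_set :: "(real^(('nz::finite \<times> 'nx::finite) + ('nu::finite \<times> 'nx))) set" where
  "disturbance_set = {vcat (vkron w\<^sub>\<Phi> w\<^sub>x) (vkron w\<^sub>u w\<^sub>x) | w\<^sub>\<Phi> w\<^sub>u w\<^sub>x.
     w\<^sub>\<Phi> \<in> cball 0 1 \<and> w\<^sub>u \<in> cball 0 1 \<and> w\<^sub>x \<in> cball 0 1}"

definition f_w ::
  "('nr::finite \<Rightarrow> real^'nx \<Rightarrow> real) \<Rightarrow> real^('nx + 'nr)^('nx + 'nr) \<Rightarrow> ('nu \<Rightarrow> real^('nx + 'nr))
    \<Rightarrow> ('nu \<Rightarrow> real^('nx + 'nr)^('nx + 'nr)) \<Rightarrow> real \<Rightarrow> real \<Rightarrow> real^'nx \<Rightarrow> real^'nu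
    \<Rightarrow> real^((('nx + 'nr) \<times> 'nx) + ('nu \<times> 'nx)) \<Rightarrow> real^'nx" where
  "f_w \<phi> A b B c\<^sub>x c\<^sub>u x u w = F_hat \<phi> A b B x u + E_mat \<phi> c\<^sub>x c\<^sub>u x u *v w"

definition closed_loop_jacobian ::
  "(real^'nx \<Rightarrow> real^'nu \<Rightarrow> 'w \<Rightarrow> real^'nx) \<Rightarrow> (real^'nx \<Rightarrow> real^'nx^'nu)
    \<Rightarrow> real^'nx \<Rightarrow> real^'nu \<Rightarrow> 'w \<Rightarrow> real^'nx^'nx" where
  "closed_loop_jacobian fw K x u w =
     jacobian (\<lambda>x'. fw x' u w) (at x) + jacobian (\<lambda>u'. fw x u' w) (at u) ** K x"

definition RCCM ::
  "((real^'nx) \<times> (real^'nu)) set \<Rightarrow> 'w set \<Rightarrow> (real^'nx \<Rightarrow> real^'nu \<Rightarrow> 'w \<Rightarrow> real^'nx)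
    \<Rightarrow> (real^'nx \<Rightarrow> real^'nx^'nx) \<Rightarrow> (real^'nx \<Rightarrow> real^'nx^'nu) \<Rightarrow> real \<Rightarrow> real \<Rightarrow> real \<Rightarrow> bool" where
  "RCCM Z W fw M K \<rho>\<^sub>c \<alpha>\<^sub>1 \<alpha>\<^sub>2 \<longleftrightarrow>
     (\<forall>x. spd (M x)) \<and> cont_diff M \<and> continuous_on UNIV K \<and>
     0 < \<rho>\<^sub>c \<and> \<rho>\<^sub>c < 1 \<and> 0 < \<alpha>\<^sub>1 \<and> 0 < \<alpha>\<^sub>2 \<and>
     (\<forall>(x, u)\<in>Z. \<forall>w\<in>W.
        let x\<^sub>p = fw x u w; A\<^sub>c\<^sub>l = closed_loop_jacobian fw K x u w in
          transpose A\<^sub>c\<^sub>l ** M x\<^sub>p ** A\<^sub>c\<^sub>l \<preceq>\<^sub>L (1 - \<rho>\<^sub>c) *\<^sub>R M x \<and>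
          \<alpha>\<^sub>1 *\<^sub>R mat 1 \<preceq>\<^sub>L M x \<and> M x \<preceq>\<^sub>L \<alpha>\<^sub>2 *\<^sub>R mat 1 \<and>
          M x\<^sub>p \<preceq>\<^sub>L \<alpha>\<^sub>2 *\<^sub>R mat 1)"

definition closed_loop_row_deriv ::
  "(real^'nx \<Rightarrow> real^'nu \<Rightarrow> real) \<Rightarrow> (real^'nx \<Rightarrow> real^'nx^'nu) \<Rightarrow> real^'nx \<Rightarrow> real^'nu
    \<Rightarrow> real^'nx" where
  "closed_loop_row_deriv hj K x u =
     row_deriv (\<lambda>x'. hj x' u) x + row_deriv (\<lambda>u'. hj x u') u v* K x"

definition curves :: "real^'n \<Rightarrow> real^'n \<Rightarrow> (real \<Rightarrow> real^'n) set" where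
  "curves xb x = {\<gamma>. \<gamma> 0 = xb \<and> \<gamma> 1 = x \<and>
     (\<exists>\<gamma>'. (\<forall>s\<in>{0..1}. (\<gamma> has_vector_derivative \<gamma>' s) (at s within {0..1})) \<and>
           continuous_on {0..1} \<gamma>')}"

abbreviation velocity :: "(real \<Rightarrow> real^'n) \<Rightarrow> real \<Rightarrow> real^'n" where
  "velocity \<gamma> s \<equiv> vector_derivative \<gamma> (at s within {0..1})"

definition curve_length :: "(real^'n \<Rightarrow> real^'n^'n) \<Rightarrow> (real \<Rightarrow> real^'n) \<Rightarrow> real" where
  "curve_length M \<gamma> = integral {0..1} (\<lambda>s. wnorm (M (\<gamma> s)) (velocity \<gamma> s))"

definition geodesic ::
  "(real^'n \<Rightarrow> real^'n^'n) \<Rightarrow> real^'n \<Rightarrow> real^'n \<Rightarrow> (real \<Rightarrow> real^'n) \<Rightarrow> bool" where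
  "geodesic M xb x \<gamma> \<longleftrightarrow>
     \<gamma> \<in> curves xb x \<and> (\<forall>\<gamma>'\<in>curves xb x. curve_length M \<gamma> \<le> curve_length M \<gamma>')"

(* The infimum is a minimum as soon as a geodesic exists. *)
definition riem_dist :: "(real^'n \<Rightarrow> real^'n^'n) \<Rightarrow> real^'n \<Rightarrow> real^'n \<Rightarrow> real" where
  "riem_dist M x xb = (INF \<gamma>\<in>curves xb x. curve_length M \<gamma>)"

definition input_curve ::
  "(real^'nx \<Rightarrow> real^'nx^'nu) \<Rightarrow> (real \<Rightarrow> real^'nx) \<Rightarrow> real^'nu \<Rightarrow> real \<Rightarrow> real^'nu" where
  "input_curve K \<gamma> ub s = ub + integral {0..s} (\<lambda>s'. K (\<gamma> s') *v velocity \<gamma> s')"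

(* geo xb x is the selected geodesic from xb to x. *)
definition feedback ::
  "(real^'nx \<Rightarrow> real^'nx^'nu) \<Rightarrow> (real^'nx \<Rightarrow> real^'nx \<Rightarrow> real \<Rightarrow> real^'nx)
    \<Rightarrow> real^'nx \<Rightarrow> real^'nx \<Rightarrow> real^'nu \<Rightarrow> real^'nu" where
  "feedback K geo x xb ub = input_curve K (geo xb x) ub 1"

end

(* Apply the closed loop, with the disturbance that reproduces the true successor state, to every
   point of the geodesic: its image is shorter by the factor sqrt (1 - rho_c).  Joining it to the
   segment from the nominal successor along which the disturbance is switched on, which is no longer
   than the second term of the recursion for delta, bounds the next distance.  This needs the whole
   geodesic, with the input interpolated along it, to lie in Z: as long as it does, h_j grows at most
   c_j times as fast as the length, so it stays nonpositive up to length delta. *)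

theory Submission
  imports Defs
begin

text \<open>The derivative bound with constant c_j is known only at points of Z, so integrating it
  along the curve would presuppose the containment to be shown; a continuation argument in the curve
  parameter is used instead. At a parameter s where h_j is active, the bound up to s and the
  tightening give c_j (\<delta> - l(s)) \<le> 0, with l(s) the length travelled. If l(s) < \<delta>,
  then c_j = 0; otherwise no length remains and the curve stands still. The case c_j = 0 is the
  delicate one: there is no margin and no information outside Z, which is where
  \<open>degenerate\<close> enters. The disturbance is chosen at the true state but kept unchanged
  at every other point: it fixes directions and a relative size, while E supplies the magnitude.
  Evaluated at the nominal point, this magnitude is at most the error bound there, and sqrt
  \<alpha>2 converts it into Riemannian length. The bound on M is known only at disturbed
  successors, so every point of the segment must be one. Curves have to be C1, so joining two of
  them must not leave a corner.\<close>

section \<open>Cholesky factors and weighted norms\<close>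

text \<open>Existence has to be shown before the choice in \<open>cholesky\<close> means anything.
  Entry functions over a finite index set permit induction by adding a new smallest index
  \<open>m\<close>: row \<open>m\<close> of the factor is row \<open>m\<close> of \<open>p\<close>
  scaled, and the remaining block factors the Schur complement.\<close>

lemma cholesky_factor_on:
  fixes p :: "'n::linorder \<Rightarrow> 'n \<Rightarrow> real"
  assumes "finite S"
    and "\<And>i j. i \<in> S \<Longrightarrow> j \<in> S \<Longrightarrow> p i j = p j i"
    and "\<And>v. \<exists>i\<in>S. v i \<noteq> 0 \<Longrightarrow> 0 < (\<Sum>i\<in>S. \<Sum>j\<in>S. v i * p i j * v j)"
  shows "\<exists>R. (\<forall>i\<in>S. \<forall>j\<in>S. j < i \<longrightarrow> R i j = (0::real)) \<and> (\<forall>i\<in>S. 0 < R i i) \<and>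
    (\<forall>i\<in>S. \<forall>j\<in>S. (\<Sum>k\<in>S. R k i * R k j) = p i j)"
  using assms
proof (induction S arbitrary: p rule: finite_linorder_min_induct)
  case empty
  then show ?case by simp
next
  case (insert m S)
  have mS: "m \<notin> S" using insert.hyps by auto
  have sym: "p i j = p j i" if "i \<in> insert m S" "j \<in> insert m S" for i j
    using insert.prems(1) that by blast
  have pos: "0 < (\<Sum>i\<in>insert m S. \<Sum>j\<in>insert m S. v i * p i j * v j)"
    if "\<exists>i\<in>insert m S. v i \<noteq> 0" for v
    using insert.prems(2) that by blast
  have pm: "0 < p m m"
  proof -
    let ?v = "\<lambda>i. if i = m then 1 else 0 :: real"
    have z: "?v i = 0" if "i \<in> S" for i using that mS by auto
    have "0 < (\<Sum>i\<in>insert m S. \<Sum>j\<in>insert m S. ?v i * p i j * ?v j)"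
      by (rule pos) auto
    also have "\<dots> = p m m"
      using insert.hyps(1) mS by (simp add: z del: if_not_P if_weak_cong cong: sum.cong_simp)
    finally show ?thesis .
  qed
  \<comment> \<open>the Schur complement of the entry at the smallest index\<close>
  define q where "q = (\<lambda>i j. p i j - p m i * p m j / p m m)"
  have quad: "0 < (\<Sum>i\<in>S. \<Sum>j\<in>S. v i * q i j * v j)" if "\<exists>i\<in>S. v i \<noteq> 0" for v
  proof -
    define t where "t = (\<Sum>j\<in>S. p m j * v j)"
    \<comment> \<open>With \<open>v\<close> given on \<open>S\<close>, this value at
      \<open>m\<close> minimises the quadratic form of \<open>p\<close>; the minimum is the
      quadratic form of the Schur complement.\<close>
    define w where "w = v(m := - t / p m m)"
    have wS: "w i = v i" if "i \<in> S" for i using that mS by (auto simp: w_def)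
    have wm: "w m = - t / p m m" by (simp add: w_def)
    have "0 < (\<Sum>i\<in>insert m S. \<Sum>j\<in>insert m S. w i * p i j * w j)"
      by (rule pos) (use that wS in auto)
    also have "\<dots> = w m * p m m * w m + w m * (\<Sum>j\<in>S. p m j * v j)
       + (\<Sum>i\<in>S. v i * p i m) * w m + (\<Sum>i\<in>S. \<Sum>j\<in>S. v i * p i j * v j)"
      using insert.hyps(1) mS
      by (simp add: wS sum.distrib sum_distrib_left sum_distrib_right mult_ac)
    also have "(\<Sum>i\<in>S. v i * p i m) = t"
      unfolding t_def using sym[of m] by (intro sum.cong) (auto simp: mult.commute)
    also have "(\<Sum>j\<in>S. p m j * v j) = t" by (simp add: t_def)
    also have "w m * p m m * w m + w m * t + t * w m = - (t * t / p m m)"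
      using pm by (simp add: wm field_simps)
    also have "- (t * t / p m m) + (\<Sum>i\<in>S. \<Sum>j\<in>S. v i * p i j * v j)
        = (\<Sum>i\<in>S. \<Sum>j\<in>S. v i * q i j * v j)"
    proof -
      have "t * t / p m m = (\<Sum>i\<in>S. \<Sum>j\<in>S. v i * (p m i * p m j / p m m) * v j)"
        unfolding t_def sum_product sum_divide_distrib
        by (intro sum.cong refl) (simp add: field_simps)
      moreover have "v i * q i j * v j = v i * p i j * v j - v i * (p m i * p m j / p m m) * v j" for i j
        unfolding q_def by (simp add: algebra_simps)
      ultimately show ?thesis by (simp add: sum_subtractf)
    qed
    finally show ?thesis .
  qed
  obtain R where R: "\<forall>i\<in>S. \<forall>j\<in>S. j < i \<longrightarrow> R i j = 0" "\<forall>i\<in>S. 0 < R i i"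
    "\<forall>i\<in>S. \<forall>j\<in>S. (\<Sum>k\<in>S. R k i * R k j) = q i j"
  proof -
    have "q i j = q j i" if "i \<in> S" "j \<in> S" for i j
      using that sym[of i j] by (simp add: q_def)
    then show ?thesis using insert.IH[of q] quad that by blast
  qed
  define R' where "R' = (\<lambda>k j. if k = m then p m j / sqrt (p m m) else if j = m then 0 else R k j)"
  have RS: "R' k j = R k j" if "k \<in> S" "j \<in> S" for k j
    using that mS by (auto simp: R'_def)
  have Rm: "R' k m = 0" if "k \<in> S" for k
    using that mS by (auto simp: R'_def)
  have row: "R' m i * R' m j = p m i * p m j / p m m" for i j
    using pm by (simp add: R'_def)
  have "(\<Sum>k\<in>insert m S. R' k i * R' k j) = p i j" if ij: "i \<in> insert m S" "j \<in> insert m S" for i j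
  proof -
    have *: "(\<Sum>k\<in>insert m S. R' k i * R' k j)
        = p m i * p m j / p m m + (\<Sum>k\<in>S. R' k i * R' k j)"
      using insert.hyps(1) mS by (simp add: row)
    consider "i = m" | "j = m" | "i \<in> S" "j \<in> S" using ij by blast
    then show ?thesis
    proof cases
      case 1
      have "(\<Sum>k\<in>S. R' k i * R' k j) = 0" using 1 Rm by simp
      then show ?thesis using 1 pm * by simp
    next
      case 2
      have "(\<Sum>k\<in>S. R' k i * R' k j) = 0" using 2 Rm by simp
      then show ?thesis using 2 pm sym[OF ij] * by simp
    next
      case 3
      then show ?thesis using R(3) unfolding * by (simp add: RS q_def)
    qed
  qed
  moreover have "\<forall>i\<in>insert m S. 0 < R' i i"
    using R(2) RS pm by (auto simp: R'_def)
  moreover have "\<forall>i\<in>insert m S. \<forall>j\<in>insert m S. j < i \<longrightarrow> R' i j = 0"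
    using R(1) RS Rm insert.hyps(2) by fastforce
  ultimately show ?case by blast
qed

lemma cholesky_mult:
  fixes P :: "(('n::{finite,linorder}), 'n) rmat"
  assumes "spd P"
  shows "transpose (cholesky P) ** cholesky P = P"
proof -
  have quad: "v \<bullet> (P *v v) = (\<Sum>i\<in>UNIV. \<Sum>j\<in>UNIV. v $ i * P $ i $ j * v $ j)" for v
    by (simp add: inner_vec_def matrix_vector_mult_def sum_distrib_left mult.assoc)
  have "P $ i $ j = P $ j $ i" for i j
  proof -
    have "transpose P $ j $ i = P $ j $ i" using assms by (simp only: spd_def)
    then show ?thesis by (simp add: transpose_def)
  qed
  moreover have "0 < (\<Sum>i\<in>UNIV. \<Sum>j\<in>UNIV. v i * P $ i $ j * v j)" if "\<exists>i\<in>UNIV. v i \<noteq> 0" for v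
  proof -
    have "(\<chi> i. v i) \<noteq> 0" using that by (auto simp: vec_eq_iff)
    then show ?thesis using assms quad[of "\<chi> i. v i"] by (auto simp: spd_def)
  qed
  ultimately obtain R where R: "\<forall>i j. j < i \<longrightarrow> R i j = 0" "\<forall>i. 0 < R i i"
      "\<forall>i j. (\<Sum>k\<in>UNIV. R k i * R k j) = P $ i $ j"
    using cholesky_factor_on[of UNIV "\<lambda>i j. P $ i $ j"] by auto
  have "(\<forall>i j. j < i \<longrightarrow> (\<chi> i j. R i j) $ i $ j = 0) \<and> (\<forall>i. 0 < (\<chi> i j. R i j) $ i $ i) \<and>
      transpose (\<chi> i j. R i j) ** (\<chi> i j. R i j) = P"
    using R by (simp add: vec_eq_iff matrix_matrix_mult_def transpose_def)
  then show ?thesis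
    unfolding cholesky_def by (rule someI2) blast
qed

section \<open>Norms weighted by a positive definite matrix\<close>

lemma norm_cholesky_mult:
  fixes P :: "(('n::{finite,linorder}), 'n) rmat"
  assumes "spd P"
  shows "norm (cholesky P *v v) = wnorm P v"
proof -
  have "(cholesky P *v v) \<bullet> (cholesky P *v v) = v \<bullet> (P *v v)"
    by (metis assms cholesky_mult dot_lmul_matrix matrix_vector_mul_assoc
        transpose_matrix_vector inner_commute)
  then show ?thesis by (simp add: wnorm_def norm_eq_sqrt_inner)
qed

lemma wnorm_pos: "spd P \<Longrightarrow> v \<noteq> 0 \<Longrightarrow> 0 < wnorm P v"
  by (simp add: spd_def wnorm_def)

lemma wnorm_zero [simp]: "wnorm P 0 = 0"
  by (simp add: wnorm_def)

lemma wnorm_nonneg: "spd P \<Longrightarrow> 0 \<le> wnorm P v"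
  by (cases "v = 0") (auto dest: wnorm_pos simp: less_imp_le)

text \<open>Insert the inverse of the Cholesky factor times the factor between \<open>a\<close> and
  \<open>v\<close> and apply Cauchy-Schwarz. This is what makes the tightening constant a rate of
  growth per unit of Riemannian length.\<close>

lemma inner_le_wnorm:
  fixes P :: "(('n::{finite,linorder}), 'n) rmat"
  assumes "spd P"
  shows "a \<bullet> v \<le> norm (a v* matrix_inv (cholesky P)) * wnorm P v"
proof -
  have "v = 0" if "cholesky P *v v = 0" for v
    using that norm_cholesky_mult[OF assms, of v] wnorm_pos[OF assms, of v] by force
  then have "invertible (cholesky P)"
    by (simp add: invertible_left_inverse matrix_left_invertible_ker)
  then have "matrix_inv (cholesky P) ** cholesky P = mat 1"
    unfolding matrix_inv_def invertible_def by (rule someI2_ex) blast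
  then have "matrix_inv (cholesky P) *v (cholesky P *v v) = v"
    using matrix_vector_mul_assoc[of "matrix_inv (cholesky P)" "cholesky P" v]
    by simp
  then have "a \<bullet> v = (a v* matrix_inv (cholesky P)) \<bullet> (cholesky P *v v)"
    by (simp add: dot_lmul_matrix)
  also have "\<dots> \<le> norm (a v* matrix_inv (cholesky P)) * norm (cholesky P *v v)"
    by (rule norm_cauchy_schwarz)
  finally show ?thesis by (simp add: norm_cholesky_mult[OF assms])
qed

lemma wnorm_scaleR: "0 \<le> c \<Longrightarrow> wnorm P (c *\<^sub>R v) = c * wnorm P v"
  by (simp add: wnorm_def matrix_vector_mult_scaleR real_sqrt_mult)

lemma wnorm_le_norm:
  assumes "P \<preceq>\<^sub>L a *\<^sub>R mat 1" "0 \<le> a"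
  shows "wnorm P v \<le> sqrt a * norm v"
proof -
  have "0 \<le> v \<bullet> ((a *\<^sub>R mat 1 - P) *v v)"
    using assms by (simp add: loewner_le_def psd_def)
  then have "v \<bullet> (P *v v) \<le> a * (v \<bullet> v)"
    by (simp add: matrix_vector_mult_diff_rdistrib inner_diff_right scaleR_matrix_vector_assoc[symmetric])
  then show ?thesis
    by (simp add: wnorm_def norm_eq_sqrt_inner flip: real_sqrt_mult)
qed

lemma wnorm_contraction:
  assumes "transpose A ** P ** A \<preceq>\<^sub>L c *\<^sub>R Q" "0 \<le> c"
  shows "wnorm P (A *v v) \<le> sqrt c * wnorm Q v"
proof -
  have "0 \<le> v \<bullet> ((c *\<^sub>R Q - transpose A ** P ** A) *v v)"
    using assms by (simp add: loewner_le_def psd_def)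
  moreover have "v \<bullet> ((transpose A ** P ** A) *v v) = (A *v v) \<bullet> (P *v (A *v v))"
    using dot_lmul_matrix[of v "transpose A" "P *v (A *v v)"]
    by (simp only: matrix_vector_mul_assoc[symmetric] vector_transpose_matrix)
  ultimately have "(A *v v) \<bullet> (P *v (A *v v)) \<le> c * (v \<bullet> (Q *v v))"
    by (simp add: matrix_vector_mult_diff_rdistrib inner_diff_right scaleR_matrix_vector_assoc[symmetric])
  then show ?thesis
    by (simp add: wnorm_def flip: real_sqrt_mult)
qed

lemma continuous_on_wnorm [continuous_intros]:
  fixes P :: "'a::topological_space \<Rightarrow> real^'n^'n"
  assumes "continuous_on S P" "continuous_on S v"
  shows "continuous_on S (\<lambda>x. wnorm (P x) (v x))"
  using assms unfolding wnorm_def matrix_vector_mult_def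
  by (intro continuous_intros) auto

section \<open>Continuously differentiable maps and paths\<close>

lemma cont_diffE:
  assumes "cont_diff f"
  obtains f' where "\<And>x. (f has_derivative blinfun_apply (f' x)) (at x)" "continuous_on UNIV f'"
  using assms unfolding cont_diff_def by auto

lemma cont_diff_differentiable: "cont_diff f \<Longrightarrow> f differentiable (at x)"
  by (erule cont_diffE) (rule differentiableI)

lemma cont_diff_continuous_on: "cont_diff f \<Longrightarrow> continuous_on S f"
  by (auto intro!: continuous_at_imp_continuous_on differentiable_imp_continuous_within cont_diff_differentiable)

lemma cont_diff_bounded_linear: "bounded_linear f \<Longrightarrow> cont_diff f"
  unfolding cont_diff_def
  by (rule exI[of _ "\<lambda>_. Blinfun f"])
     (simp add: bounded_linear_Blinfun_apply bounded_linear_imp_has_derivative)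

lemma cont_diff_const: "cont_diff (\<lambda>_. k)"
  unfolding cont_diff_def by (rule exI[of _ "\<lambda>_. 0"]) (simp add: zero_blinfun.rep_eq)

lemma cont_diff_add: 
  assumes "cont_diff f" "cont_diff g"
  shows "cont_diff (\<lambda>x. f x + g x)"
proof -
  obtain f' where f: "\<And>x. (f has_derivative blinfun_apply (f' x)) (at x)" "continuous_on UNIV f'"
    using assms(1) by (rule cont_diffE) blast
  obtain g' where g: "\<And>x. (g has_derivative blinfun_apply (g' x)) (at x)" "continuous_on UNIV g'"
    using assms(2) by (rule cont_diffE) blast
  with f g show ?thesis unfolding cont_diff_def
    by (intro exI[of _ "\<lambda>x. f' x + g' x"])
       (auto simp: plus_blinfun.rep_eq intro!: has_derivative_add continuous_intros)
qed

lemma cont_diff_sum: "(\<And>i. i \<in> I \<Longrightarrow> cont_diff (f i)) \<Longrightarrow> cont_diff (\<lambda>x. \<Sum>i\<in>I. f i x)"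
  by (induction I rule: infinite_finite_induct) (auto intro: cont_diff_const cont_diff_add)

lemma cont_diff_compose:
  assumes "cont_diff f" "cont_diff g"
  shows "cont_diff (\<lambda>x. f (g x))"
proof -
  obtain f' where f: "\<And>x. (f has_derivative blinfun_apply (f' x)) (at x)" "continuous_on UNIV f'"
    using assms(1) by (rule cont_diffE) blast
  obtain g' where g: "\<And>x. (g has_derivative blinfun_apply (g' x)) (at x)" "continuous_on UNIV g'"
    using assms(2) by (rule cont_diffE) blast
  have "continuous_on UNIV (\<lambda>x. f' (g x) o\<^sub>L g' x)"
    using f g cont_diff_continuous_on[OF assms(2)]
    by (intro continuous_intros continuous_on_compose2[OF f(2)]) auto
  moreover have "((\<lambda>x. f (g x)) has_derivative blinfun_apply (f' (g x) o\<^sub>L g' x)) (at x)" for x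
    using has_derivative_compose[OF g(1) f(1)] by (simp add: blinfun_compose.rep_eq o_def)
  ultimately show ?thesis
    unfolding cont_diff_def by (intro exI[of _ "\<lambda>x. f' (g x) o\<^sub>L g' x"]) simp
qed

lemma cont_diff_linear_compose:
  "bounded_linear L \<Longrightarrow> cont_diff f \<Longrightarrow> cont_diff (\<lambda>x. L (f x))"
  by (rule cont_diff_compose[OF cont_diff_bounded_linear])

lemma cont_diff_scaleR:
  assumes "cont_diff f" "cont_diff g"
  shows "cont_diff (\<lambda>x. f x *\<^sub>R g x)"
proof -
  obtain f' where f: "\<And>x. (f has_derivative blinfun_apply (f' x)) (at x)" "continuous_on UNIV f'"
    using assms(1) by (rule cont_diffE) blast
  obtain g' where g: "\<And>x. (g has_derivative blinfun_apply (g' x)) (at x)" "continuous_on UNIV g'"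
    using assms(2) by (rule cont_diffE) blast
  note cont = assms[THEN cont_diff_continuous_on]
  define d where "d x = f x *\<^sub>R g' x + (blinfun_scaleR_left (g x) o\<^sub>L f' x)" for x
  have "continuous_on UNIV d"
    unfolding d_def using f g cont by (intro continuous_intros) auto
  moreover have "((\<lambda>x. f x *\<^sub>R g x) has_derivative blinfun_apply (d x)) (at x)" for x
    using has_derivative_scaleR[OF f(1) g(1)]
    by (simp add: d_def plus_blinfun.rep_eq scaleR_blinfun.rep_eq)
  ultimately show ?thesis unfolding cont_diff_def by blast
qed

text \<open>The derivative is an explicit argument, so that it can be built up by rules. The
  codomain is any normed space because the pair of state and input is treated as one path.\<close>

definition C1_path :: "(real \<Rightarrow> 'a::real_normed_vector) \<Rightarrow> (real \<Rightarrow> 'a) \<Rightarrow> bool" where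
  "C1_path \<gamma> \<gamma>' \<longleftrightarrow> continuous_on {0..1} \<gamma>' \<and>
     (\<forall>s\<in>{0..1}. (\<gamma> has_vector_derivative \<gamma>' s) (at s within {0..1}))"

lemma C1_path_continuous: "C1_path \<gamma> \<gamma>' \<Longrightarrow> continuous_on {0..1} \<gamma>"
  unfolding C1_path_def continuous_on_eq_continuous_within
  using has_vector_derivative_continuous by blast

lemma C1_path_velocity: "C1_path \<gamma> \<gamma>' \<Longrightarrow> s \<in> {0..1} \<Longrightarrow> velocity \<gamma> s = \<gamma>' s"
  using vector_derivative_within_cbox[of 0 1 s \<gamma> "\<gamma>' s"] by (simp add: C1_path_def)

lemma C1_path_curves: "C1_path \<gamma> \<gamma>' \<Longrightarrow> \<gamma> \<in> curves (\<gamma> 0) (\<gamma> 1)"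
  unfolding C1_path_def curves_def by blast

lemma curves_C1_path:
  assumes "\<gamma> \<in> curves a b"
  shows "C1_path \<gamma> (velocity \<gamma>)"
proof -
  from assms obtain \<gamma>' where *: "C1_path \<gamma> \<gamma>'" unfolding curves_def C1_path_def by blast
  then have "continuous_on {0..1} (velocity \<gamma>)"
    using C1_path_velocity[OF *] continuous_on_cong[of "{0..1}" "{0..1}" "velocity \<gamma>" \<gamma>'] 
    by (simp add: C1_path_def)
  then show ?thesis using * C1_path_velocity[OF *] by (simp add: C1_path_def)
qed

lemma C1_path_compose:
  assumes "cont_diff f" "C1_path \<zeta> \<zeta>'"
  shows "C1_path (\<lambda>s. f (\<zeta> s)) (\<lambda>s. frechet_derivative f (at (\<zeta> s)) (\<zeta>' s))"
proof -
  obtain f' where *: "\<And>x. (f has_derivative blinfun_apply (f' x)) (at x)" "continuous_on UNIV f'"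
    using assms(1) by (rule cont_diffE) blast
  have eq: "frechet_derivative f (at x) = blinfun_apply (f' x)" for x
    using frechet_derivative_at[OF *(1)] by (rule sym)
  have "continuous_on {0..1} (\<lambda>s. blinfun_apply (f' (\<zeta> s)) (\<zeta>' s))"
    using assms(2) C1_path_continuous[OF assms(2)]
    by (intro continuous_intros continuous_on_compose2[OF *(2)]) (auto simp: C1_path_def)
  moreover have "((\<lambda>s. f (\<zeta> s)) has_vector_derivative blinfun_apply (f' (\<zeta> s)) (\<zeta>' s)) (at s within {0..1})"
    if "s \<in> {0..1}" for s
    using assms(2) that unfolding C1_path_def
    by (intro vector_derivative_diff_chain_within[unfolded o_def, OF _ has_derivative_at_withinI[OF *(1)]]) auto
  ultimately show ?thesis by (simp add: C1_path_def eq)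
qed

section \<open>Pairs of paths and partial derivatives\<close>

lemma C1_path_Pair:
  "C1_path \<gamma> \<gamma>' \<Longrightarrow> C1_path \<eta> \<eta>' \<Longrightarrow> C1_path (\<lambda>s. (\<gamma> s, \<eta> s)) (\<lambda>s. (\<gamma>' s, \<eta>' s))"
  unfolding C1_path_def by (auto intro!: continuous_intros has_vector_derivative_Pair)

text \<open>The closed-loop derivatives are defined by partial derivatives, whereas the chain rule
  along a path of pairs produces the total derivative. Linearity on (v, 0) + (0, w) reconciles the
  two.\<close>

lemma frechet_derivative_Pair_split:
  fixes f :: "'a::real_normed_vector \<times> 'b::real_normed_vector \<Rightarrow> 'c::real_normed_vector"
  assumes "f differentiable (at (x, u))"
  shows "frechet_derivative f (at (x, u)) (v, w)
    = frechet_derivative (\<lambda>x'. f (x', u)) (at x) v + frechet_derivative (\<lambda>u'. f (x, u')) (at u) w"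
    and "(\<lambda>x'. f (x', u)) differentiable (at x)" and "(\<lambda>u'. f (x, u')) differentiable (at u)"
proof -
  let ?D = "frechet_derivative f (at (x, u))"
  have D: "(f has_derivative ?D) (at (x, u))"
    using assms by (rule frechet_derivative_works[THEN iffD1])
  have x: "((\<lambda>x'. f (x', u)) has_derivative (\<lambda>v. ?D (v, 0))) (at x)"
    by (rule has_derivative_compose[where f = "\<lambda>x'. (x', u)" and x = x and g = f and f' = "\<lambda>v. (v, 0)", OF _ D])
       (auto intro!: derivative_eq_intros)
  have u: "((\<lambda>u'. f (x, u')) has_derivative (\<lambda>w. ?D (0, w))) (at u)"
    by (rule has_derivative_compose[where f = "\<lambda>u'. (x, u')" and x = u and g = f and f' = "\<lambda>w. (0, w)", OF _ D])
       (auto intro!: derivative_eq_intros)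
  show "(\<lambda>x'. f (x', u)) differentiable (at x)" "(\<lambda>u'. f (x, u')) differentiable (at u)"
    using x u by (auto intro: differentiableI)
  have "?D (v, w) = ?D (v, 0) + ?D (0, w)"
    using linear_add[OF has_derivative_linear[OF D], of "(v, 0)" "(0, w)"] by simp
  then show "?D (v, w) = frechet_derivative (\<lambda>x'. f (x', u)) (at x) v + frechet_derivative (\<lambda>u'. f (x, u')) (at u) w"
    using fun_cong[OF frechet_derivative_at[OF x], of v] fun_cong[OF frechet_derivative_at[OF u], of w]
    by simp
qed

text \<open>When the input velocity is \<open>K\<close> times the state velocity, the tangent of the
  path of pairs is \<open>(v, K x *v v)\<close>; hence the closed-loop Jacobian describes the
  velocity of the image curve.\<close>

lemma closed_loop_jacobian_mult:
  assumes "(\<lambda>(x, u). f x u w) differentiable (at (x, u))"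
  shows "closed_loop_jacobian f K x u w *v v
    = frechet_derivative (\<lambda>(x, u). f x u w) (at (x, u)) (v, K x *v v)"
proof -
  have jac: "jacobian h (at a) *v b = frechet_derivative h (at a) b"
    if "h differentiable (at a)" for h :: "real^'k \<Rightarrow> real^'l" and a b
    using fun_cong[OF matrix_vector_mul(2)[OF linear_frechet_derivative[OF that]]]
    by (simp add: jacobian_def)
  show ?thesis
    using frechet_derivative_Pair_split[OF assms]
    by (simp add: closed_loop_jacobian_def matrix_vector_mult_add_rdistrib
        matrix_vector_mul_assoc[symmetric] jac)
qed

lemma row_deriv_inner:
  assumes "f differentiable (at x)"
  shows "row_deriv f x \<bullet> v = frechet_derivative f (at x) v"
proof -
  have "frechet_derivative f (at x) v = frechet_derivative f (at x) (\<Sum>i\<in>UNIV. v $ i *\<^sub>R axis i 1)"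
    by (simp add: basis_expansion[of v, unfolded scalar_mult_eq_scaleR])
  also have "\<dots> = (\<Sum>i\<in>UNIV. v $ i * frechet_derivative f (at x) (axis i 1))"
    using linear_frechet_derivative[OF assms] by (simp add: linear_sum linear_cmul)
  finally show ?thesis by (simp add: row_deriv_def inner_vec_def mult.commute)
qed

lemma closed_loop_row_deriv_inner:
  assumes "(\<lambda>(x, u). f x u) differentiable (at (x, u))"
  shows "closed_loop_row_deriv f K x u \<bullet> v
    = frechet_derivative (\<lambda>(x, u). f x u) (at (x, u)) (v, K x *v v)"
  using frechet_derivative_Pair_split[OF assms]
  by (simp add: closed_loop_row_deriv_def inner_add_left dot_lmul_matrix row_deriv_inner)

section \<open>Riemannian distance\<close>

text \<open>Squaring removes the kink: at 0 the difference quotient is at most |h|. This gives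
  parametrisations that come to rest smoothly at a junction of curves.\<close>

lemma has_real_derivative_max0_square:
  "((\<lambda>x::real. (max 0 x)\<^sup>2) has_real_derivative 2 * max 0 x) (at x)"
proof -
  consider "x < 0" | "x = 0" | "x > 0" by linarith
  then show ?thesis
  proof cases
    case 1
    have "((\<lambda>x::real. 0) has_real_derivative 2 * max 0 x) (at x)" using 1 by simp
    then show ?thesis
      by (rule has_field_derivative_transform_within_open[of _ _ _ "{..<0}"]) (use 1 in auto)
  next
    case 2
    have "((\<lambda>h::real. (max 0 h)\<^sup>2 / h) \<longlongrightarrow> 0) (at 0)"
      by (rule Lim_null_comparison[of _ "\<lambda>h. \<bar>h\<bar>"])
         (auto simp: max_def power2_eq_square intro!: always_eventually tendsto_eq_intros)
    then show ?thesis using 2 by (simp add: DERIV_def)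
  next
    case 3
    have "((\<lambda>x::real. x\<^sup>2) has_real_derivative 2 * max 0 x) (at x)"
      using 3 by (auto intro!: derivative_eq_intros)
    then show ?thesis
      by (rule has_field_derivative_transform_within_open[of _ _ _ "{0<..}"]) (use 3 in auto)
  qed
qed

lemma curve_length_nonneg:
  assumes "\<And>x. spd (M x)"
  shows "0 \<le> curve_length M \<gamma>"
  unfolding curve_length_def
  \<comment> \<open>For an arbitrary function the speed may fail to be integrable; the length is
    then 0, the default value of \<open>integral\<close>.\<close>
  by (cases "(\<lambda>s. wnorm (M (\<gamma> s)) (velocity \<gamma> s)) integrable_on {0..1}")
     (auto intro: integral_nonneg simp: assms wnorm_nonneg not_integrable_integral)

lemma riem_dist_le:
  assumes "\<And>x. spd (M x)" "\<gamma> \<in> curves a b"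
  shows "riem_dist M b a \<le> curve_length M \<gamma>"
  unfolding riem_dist_def
  by (rule cINF_lower[OF _ assms(2)]) (auto intro!: bdd_belowI[of _ 0] curve_length_nonneg assms)

lemma riem_dist_geodesic: "geodesic M a b \<gamma> \<Longrightarrow> riem_dist M b a = curve_length M \<gamma>"
  unfolding riem_dist_def geodesic_def by (intro cInf_eq_minimum) auto

lemma curve_length_C1:
  assumes "C1_path \<gamma> \<gamma>'"
  shows "curve_length M \<gamma> = integral {0..1} (\<lambda>s. wnorm (M (\<gamma> s)) (\<gamma>' s))"
  unfolding curve_length_def
  by (rule integral_cong) (simp add: C1_path_velocity[OF assms])

lemma continuous_on_speed:
  assumes "C1_path \<gamma> \<gamma>'" "continuous_on UNIV M"
  shows "continuous_on {0..1} (\<lambda>s. wnorm (M (\<gamma> s)) (\<gamma>' s))"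
  using assms C1_path_continuous[OF assms(1)]
  by (intro continuous_on_wnorm continuous_on_compose2[OF assms(2)]) (auto simp: C1_path_def)

lemma C1_path_reparam:
  assumes "C1_path \<gamma> \<gamma>'" and t: "t ` {0..1} \<subseteq> {0..1}" "continuous_on {0..1} t'"
    "\<And>s. (t has_real_derivative t' s) (at s)"
  shows "C1_path (\<lambda>s. \<gamma> (t s)) (\<lambda>s. t' s *\<^sub>R \<gamma>' (t s))"
proof -
  have "continuous_on {0..1} t"
    using t(3) by (auto intro!: continuous_at_imp_continuous_on DERIV_isCont)
  moreover have "continuous_on {0..1} \<gamma>'" using assms(1) by (simp add: C1_path_def)
  ultimately have "continuous_on {0..1} (\<lambda>s. t' s *\<^sub>R \<gamma>' (t s))"
    using t by (intro continuous_intros continuous_on_compose2[of "{0..1}" \<gamma>' "{0..1}" t]) auto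
  moreover have "((\<lambda>s. \<gamma> (t s)) has_vector_derivative t' s *\<^sub>R \<gamma>' (t s)) (at s within {0..1})"
    if s: "s \<in> {0..1}" for s
  proof -
    have "(t has_vector_derivative t' s) (at s within {0..1})"
      using t(3) by (simp add: has_real_derivative_iff_has_vector_derivative has_vector_derivative_at_within)
    moreover have "(\<gamma> has_vector_derivative \<gamma>' (t s)) (at (t s) within t ` {0..1})"
      by (rule has_vector_derivative_within_subset[OF _ t(1)])
         (use assms(1) s t(1) in \<open>auto simp: C1_path_def image_subset_iff\<close>)
    ultimately show ?thesis using vector_diff_chain_within by (fastforce simp: o_def)
  qed
  ultimately show ?thesis by (simp add: C1_path_def)
qed

lemma C1_path_add:
  "C1_path \<gamma> \<gamma>' \<Longrightarrow> C1_path \<eta> \<eta>' \<Longrightarrow> C1_path (\<lambda>s. \<gamma> s + \<eta> s) (\<lambda>s. \<gamma>' s + \<eta>' s)"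
  unfolding C1_path_def by (auto intro!: continuous_intros has_vector_derivative_add)

lemma C1_path_const: "C1_path (\<lambda>_. a) (\<lambda>_. 0)"
  unfolding C1_path_def by auto

text \<open>The two curves are traversed with speed vanishing at the junction, so the concatenation is
  again continuously differentiable.\<close>

lemma curves_concat:
  assumes M: "\<And>x. spd (M x)" "continuous_on UNIV M"
    and \<gamma>: "\<gamma> \<in> curves a b" and \<eta>: "\<eta> \<in> curves b c"
  obtains \<zeta> where "\<zeta> \<in> curves a c" "curve_length M \<zeta> = curve_length M \<gamma> + curve_length M \<eta>"
proof -
  define \<gamma>' where "\<gamma>' = velocity \<gamma>"
  define \<eta>' where "\<eta>' = velocity \<eta>"
  have paths: "C1_path \<gamma> \<gamma>'" "C1_path \<eta> \<eta>'"
    using \<gamma> \<eta> curves_C1_path by (auto simp: \<gamma>'_def \<eta>'_def)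
  have ends: "\<gamma> 0 = a" "\<gamma> 1 = b" "\<eta> 0 = b" "\<eta> 1 = c" using \<gamma> \<eta> by (auto simp: curves_def)
  \<comment> \<open>\<open>p\<close> runs from 0 to 1 on [0, 1/2] and rests at 1 afterwards;
    \<open>q\<close> rests at 0 until 1/2 and then runs to 1. Both derivatives vanish at
    1/2.\<close>
  define p :: "real \<Rightarrow> real" where "p s = 1 - (max 0 (1 - 2 * s))\<^sup>2" for s
  define q :: "real \<Rightarrow> real" where "q s = (max 0 (2 * s - 1))\<^sup>2" for s
  define p' :: "real \<Rightarrow> real" where "p' s = 4 * max 0 (1 - 2 * s)" for s
  define q' :: "real \<Rightarrow> real" where "q' s = 4 * max 0 (2 * s - 1)" for s
  have chain: "((\<lambda>s. (max 0 (r s))\<^sup>2) has_real_derivative 2 * max 0 (r s) * d) (at s)"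
    if "(r has_real_derivative d) (at s)" for r d and s :: real
    using DERIV_chain2[OF has_real_derivative_max0_square that] .
  have dp: "(p has_real_derivative p' s) (at s)" for s
  proof -
    have "((\<lambda>s. 1 - 2 * s) has_real_derivative - 2) (at s)" by (auto intro!: derivative_eq_intros)
    from DERIV_diff[OF DERIV_const[of 1] chain[OF this]] show ?thesis
      by (simp add: p_def[abs_def] p'_def mult.commute)
  qed
  have dq: "(q has_real_derivative q' s) (at s)" for s
  proof -
    have "((\<lambda>s. 2 * s - 1) has_real_derivative 2) (at s)" by (auto intro!: derivative_eq_intros)
    from chain[OF this] show ?thesis by (simp add: q_def[abs_def] q'_def mult.commute)
  qed
  have cont: "continuous_on {0..1} p'" "continuous_on {0..1} q'"
    unfolding p'_def q'_def by (intro continuous_intros)+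
  have range: "p ` {0..1} \<subseteq> {0..1}" "q ` {0..1} \<subseteq> {0..1}"
    unfolding p_def q_def by (auto simp: power_le_one max_def)
  have pq: "p s = 1 \<and> p' s = 0 \<or> q s = 0 \<and> q' s = 0" for s
    unfolding p_def q_def p'_def q'_def by (auto simp: max_def)
  have nonneg: "0 \<le> p' s" "0 \<le> q' s" for s by (auto simp: p'_def q'_def)
  \<comment> \<open>At every parameter one of the two curves sits at \<open>b\<close>, which the
    last term cancels. Writing the concatenation as a sum avoids a case distinction when
    differentiating.\<close>
  define \<zeta> where "\<zeta> s = \<gamma> (p s) + \<eta> (q s) + - b" for s
  define \<zeta>' where "\<zeta>' s = p' s *\<^sub>R \<gamma>' (p s) + q' s *\<^sub>R \<eta>' (q s) + 0" for s
  have \<zeta>: "C1_path \<zeta> \<zeta>'"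
    unfolding \<zeta>_def \<zeta>'_def
    by (intro C1_path_add C1_path_const C1_path_reparam paths range cont dp dq)
  have mem: "\<zeta> \<in> curves a c"
    using C1_path_curves[OF \<zeta>] ends by (simp add: \<zeta>_def p_def q_def)
  define v where "v s = wnorm (M (\<gamma> s)) (\<gamma>' s)" for s
  define w where "w s = wnorm (M (\<eta> s)) (\<eta>' s)" for s
  have vw: "continuous_on {0..1} v" "continuous_on {0..1} w"
    unfolding v_def w_def by (intro continuous_on_speed paths M)+
  have speed: "wnorm (M (\<zeta> s)) (\<zeta>' s) = p' s * v (p s) + q' s * w (q s)" for s
    using pq[of s] by (auto simp: \<zeta>_def \<zeta>'_def v_def w_def ends wnorm_scaleR nonneg)
  \<comment> \<open>The arc length travelled up to \<open>s\<close>, as an antiderivative of the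
    speed on all of [0, 1]; no splitting at 1/2 is needed.\<close>
  let ?\<Lambda> = "\<lambda>s. integral {0..p s} v + integral {0..q s} w"
  have deriv: "((\<lambda>s. integral {0..r s} y) has_vector_derivative r' s * y (r s)) (at s within {0..1})"
    if "continuous_on {0..1} y" "r ` {0..1} \<subseteq> {0..1}" "s \<in> {0..1}"
      "\<And>s. (r has_real_derivative r' s) (at s)" for r r' y :: "real \<Rightarrow> real" and s
  proof -
    have "r s \<in> {0..1}" using that(2,3) by blast
    then have "((\<lambda>t. integral {0..t} y) has_vector_derivative y (r s)) (at (r s) within r ` {0..1})"
      by (rule has_vector_derivative_within_subset[OF integral_has_vector_derivative[OF that(1)] that(2)])
    moreover have "(r has_vector_derivative r' s) (at s within {0..1})"
      using that(4) by (simp add: has_real_derivative_iff_has_vector_derivative has_vector_derivative_at_within)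
    ultimately show ?thesis using vector_diff_chain_within by (fastforce simp: o_def)
  qed
  have "((\<lambda>s. p' s * v (p s) + q' s * w (q s)) has_integral (?\<Lambda> 1 - ?\<Lambda> 0)) {0..1}"
    by (rule fundamental_theorem_of_calculus)
       (auto intro!: has_vector_derivative_add deriv vw range dp dq simp del: image_subset_iff)
  then have "curve_length M \<zeta> = integral {0..1} v + integral {0..1} w"
    by (simp add: curve_length_C1[OF \<zeta>] speed p_def q_def integral_unique)
  also have "\<dots> = curve_length M \<gamma> + curve_length M \<eta>"
    by (simp add: curve_length_C1[OF paths(1)] curve_length_C1[OF paths(2)] v_def[abs_def] w_def[abs_def])
  finally show ?thesis using that mem by blast
qed

text \<open>Real induction: let m be the supremum of the parameters up to which \<open>P\<close>
  holds throughout. \<open>left\<close> carries \<open>P\<close> to m itself, and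
  \<open>right\<close> would carry it beyond m if m < 1.\<close>

lemma unit_interval_induct:
  fixes P :: "real \<Rightarrow> bool"
  assumes P0: "P 0"
    and left: "\<And>s. 0 < s \<Longrightarrow> s \<le> 1 \<Longrightarrow> (\<And>t. 0 \<le> t \<Longrightarrow> t < s \<Longrightarrow> P t) \<Longrightarrow> P s"
    and right: "\<And>s. 0 \<le> s \<Longrightarrow> s < 1 \<Longrightarrow> (\<And>t. 0 \<le> t \<Longrightarrow> t \<le> s \<Longrightarrow> P t) \<Longrightarrow>
      \<exists>r>s. \<forall>t\<in>{s..r}. t \<le> 1 \<longrightarrow> P t"
  shows "\<forall>s\<in>{0..1}. P s"
proof -
  define S where "S = {s \<in> {0..1}. \<forall>t\<in>{0..s}. P t}"
  have S0: "0 \<in> S" using P0 by (auto simp: S_def)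
  have bdd: "bdd_above S" by (auto simp: S_def intro!: bdd_aboveI[of _ 1])
  define m where "m = Sup S"
  have m: "0 \<le> m" "m \<le> 1"
    unfolding m_def using cSup_upper[OF S0 bdd] S0
    by (auto intro!: cSup_least simp: S_def)
  have below: "P t" if "0 \<le> t" "t < m" for t
    using that S0 less_cSup_iff[OF _ bdd] unfolding m_def S_def by force
  have "P m"
    using left[of m] below m P0 by (cases "m = 0") auto
  then have upto: "P t" if "0 \<le> t" "t \<le> m" for t using below that by (cases "t = m") auto
  have "m = 1"
  proof (rule ccontr)
    assume "m \<noteq> 1"
    then obtain r where r: "r > m" "\<forall>t\<in>{m..r}. t \<le> 1 \<longrightarrow> P t"
      using right[of m] m upto by auto
    then have "min r 1 \<in> S" using upto m by (auto simp: S_def)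
    then have "min r 1 \<le> m" unfolding m_def by (rule cSup_upper[OF _ bdd])
    then show False using r m \<open>m \<noteq> 1\<close> by auto
  qed
  then show ?thesis using upto by auto
qed

section \<open>Constraint satisfaction along the geodesic\<close>

text \<open>The difference \<open>f - g\<close> is nonincreasing on [a, b]. The comparison of
  derivatives is required on [a, b] only, since in the continuation argument it is known only up to
  the parameter already reached.\<close>

lemma increment_mono:
  fixes f g :: "real \<Rightarrow> real"
  assumes f: "\<And>t. t \<in> {0..1} \<Longrightarrow> (f has_real_derivative f' t) (at t within {0..1})"
    and g: "\<And>t. t \<in> {0..1} \<Longrightarrow> (g has_real_derivative g' t) (at t within {0..1})"
    and ab: "0 \<le> a" "a \<le> b" "b \<le> 1" and le: "\<And>t. a \<le> t \<Longrightarrow> t \<le> b \<Longrightarrow> f' t \<le> g' t"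
  shows "f b - f a \<le> g b - g a"
proof -
  have d: "((\<lambda>t. f t - g t) has_real_derivative f' t - g' t) (at t within {0..1})" if "t \<in> {0..1}" for t
    using f g that by (intro DERIV_diff)
  have "continuous_on {0..1} (\<lambda>t. f t - g t)"
    using d by (rule DERIV_continuous_on)
  then have "continuous_on {a..b} (\<lambda>t. f t - g t)"
    by (rule continuous_on_subset) (use ab in auto)
  moreover have "\<exists>y. ((\<lambda>t. f t - g t) has_real_derivative y) (at t) \<and> y \<le> 0" if "a < t" "t < b" for t
    using d[of t] le[of t] that ab by (auto simp: at_within_Icc_at)
  ultimately have "f b - g b \<le> f a - g a"
    using DERIV_nonpos_imp_decreasing_open[OF ab(2)] by blast
  then show ?thesis by simp
qed

text \<open>If a constraint becomes active at some time, then either its tightening is used up, so that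
  the remaining length is zero and all constraints stay constant, or its tightening constant vanishes
  and the constraint was already active at the start.\<close>

lemma tightened_constraints:
  fixes q q' :: "'j::finite \<Rightarrow> real \<Rightarrow> real" and v :: "real \<Rightarrow> real"
  assumes dq: "\<And>j s. s \<in> {0..1} \<Longrightarrow> (q j has_real_derivative q' j s) (at s within {0..1})"
    and v: "continuous_on {0..1} v" "\<And>s. 0 \<le> v s"
    and c: "\<And>j. 0 \<le> c j"
    and bound: "\<And>j s. s \<in> {0..1} \<Longrightarrow> \<forall>i. q i s \<le> 0 \<Longrightarrow> q' j s \<le> c j * v s"
    and still: "\<And>j s. s \<in> {0..1} \<Longrightarrow> v s = 0 \<Longrightarrow> q' j s = 0"
    and tight: "\<And>j. q j 0 + c j * \<delta> \<le> 0" and len: "integral {0..1} v \<le> \<delta>"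
    and degen: "\<And>j s. c j = 0 \<Longrightarrow> q j 0 = 0 \<Longrightarrow> 0 \<le> s \<Longrightarrow> s < 1 \<Longrightarrow> \<forall>i. q i s \<le> 0 \<Longrightarrow>
      \<exists>r>s. \<forall>t\<in>{s..r}. t \<le> 1 \<longrightarrow> q' j t = 0"
  shows "\<forall>s\<in>{0..1}. \<forall>j. q j s \<le> 0"
proof (rule unit_interval_induct)
  have v_int: "v integrable_on {a..b}" if "0 \<le> a" "b \<le> 1" for a b
    using that by (intro integrable_continuous_interval continuous_on_subset[OF v(1)]) auto
  have "0 \<le> \<delta>"
    using len integral_nonneg[OF v_int[of 0 1]] v(2) by fastforce
  then show "\<forall>j. q j 0 \<le> 0"
    using tight c by (smt (verit) mult_nonneg_nonneg)
next
  fix s :: real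
  assume s: "0 < s" "s \<le> 1" and before: "\<And>t. 0 \<le> t \<Longrightarrow> t < s \<Longrightarrow> \<forall>j. q j t \<le> 0"
  show "\<forall>j. q j s \<le> 0"
  proof
    fix j
    have "continuous_on {0..1} (q j)" using dq by (rule DERIV_continuous_on)
    then have "continuous_on (closure {0..<s}) (q j)"
      using s by (auto elim: continuous_on_subset)
    then show "q j s \<le> 0"
      by (rule continuous_le_on_closure) (use s before in auto)
  qed
next
  fix s :: real
  assume s: "0 \<le> s" "s < 1" and before: "\<And>t. 0 \<le> t \<Longrightarrow> t \<le> s \<Longrightarrow> \<forall>j. q j t \<le> 0"
  show "\<exists>r>s. \<forall>t\<in>{s..r}. t \<le> 1 \<longrightarrow> (\<forall>j. q j t \<le> 0)"
  proof (cases "\<forall>t\<in>{s..1}. v t = 0")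
    case True
    have "q j t \<le> 0" if "t \<in> {s..1}" for j t
    proof -
      have "q j t - q j s \<le> 0 - 0"
        by (rule increment_mono[where g' = "\<lambda>_. 0" and g = "\<lambda>_. 0", OF dq])
           (use that s still True in auto)
      then show ?thesis using before[of s] s by (smt (verit))
    qed
    then show ?thesis using s by (intro exI[of _ 1]) auto
  next
    case False
    define \<l> where "\<l> t = integral {0..t} v" for t
    have vs: "continuous_on {s..1} v" using s by (intro continuous_on_subset[OF v(1)]) auto
    have v_int: "v integrable_on {a..b}" if "0 \<le> a" "b \<le> 1" for a b
      using that by (intro integrable_continuous_interval continuous_on_subset[OF v(1)]) auto
    \<comment> \<open>A continuous nonnegative speed with zero integral vanishes identically; so a
      positive length still lies ahead, and strictly less than \<delta> has been used.\<close>
    have "integral {s..1} v \<noteq> 0"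
      using integral_eq_0_iff[OF vs s(2)] v(2) False by blast
    moreover have "0 \<le> integral {s..1} v"
      using v_int s v(2) by (intro integral_nonneg) auto
    moreover have "\<l> s + integral {s..1} v = \<l> 1"
      unfolding \<l>_def using s v_int by (intro Henstock_Kurzweil_Integration.integral_combine) auto
    ultimately have short: "\<l> s < \<delta>" using len by (simp add: \<l>_def)
    have d\<l>: "((\<lambda>t. c j * \<l> t) has_real_derivative c j * v t) (at t within {0..1})"
      if "t \<in> {0..1}" for j t
      unfolding \<l>_def
      by (intro DERIV_cmult integral_has_real_derivative v(1) that)
    have local: "\<exists>r>s. \<forall>t\<in>{s..r}. t \<le> 1 \<longrightarrow> q j t \<le> 0" for j
    proof (cases "q j s < 0")
      case True
      have "(q j \<longlongrightarrow> q j s) (at s within {0..1})"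
        using DERIV_continuous[OF dq, of s j] s by (simp add: continuous_within)
      then have "eventually (\<lambda>t. q j t < 0) (at s within {0..1})"
        using True by (rule order_tendstoD)
      then obtain d where d: "d > 0" "\<forall>t\<in>{0..1}. t \<noteq> s \<and> dist t s < d \<longrightarrow> q j t < 0"
        unfolding eventually_at by blast
      have "q j t \<le> 0" if "t \<in> {s..s + d / 2}" "t \<le> 1" for t
        using d that True s by (cases "t = s") (auto simp: dist_real_def intro!: less_imp_le)
      then show ?thesis using d(1) by (intro exI[of _ "s + d / 2"]) auto
    next
      case False
      moreover have "q j s \<le> 0" using before[of s] s by simp
      ultimately have qs: "q j s = 0" by simp
      have "q j s - q j 0 \<le> c j * \<l> s - c j * \<l> 0"
        by (rule increment_mono[OF dq d\<l>]) (use s bound before in auto)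
      then have grow: "0 \<le> q j 0 + c j * \<l> s" using qs by (simp add: \<l>_def)
      \<comment> \<open>The start leaves a margin of at least \<open>c j * \<delta>\<close>, and the
        growth up to \<open>s\<close> is at most \<open>c j * \<l> s\<close>. Being active after
        less than length \<delta> therefore forces \<open>c j = 0\<close>.\<close>
      then have "c j * (\<delta> - \<l> s) \<le> 0" using tight[of j] by (simp add: algebra_simps)
      then have "c j = 0" using short c[of j] by (simp add: mult_le_0_iff)
      moreover have "q j 0 = 0" using grow \<open>c j = 0\<close> tight[of j] by simp
      ultimately obtain r where r: "r > s" "\<forall>t\<in>{s..r}. t \<le> 1 \<longrightarrow> q' j t = 0"
        using degen[of j s] s before by auto
      have "q j t \<le> 0" if "t \<in> {s..r}" "t \<le> 1" for t
      proof -
        have "q j t - q j s \<le> 0 - 0"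
          by (rule increment_mono[where g' = "\<lambda>_. 0" and g = "\<lambda>_. 0", OF dq])
             (use that s r in auto)
        then show ?thesis using qs by simp
      qed
      then show ?thesis using r by blast
    qed
    then obtain r where r: "\<And>j. r j > s" "\<And>j. \<forall>t\<in>{s..r j}. t \<le> 1 \<longrightarrow> q j t \<le> 0"
      by metis
    \<comment> \<open>There are finitely many constraints, so one interval after \<open>s\<close>
      serves them all.\<close>
    have "Min (range r) > s" "\<And>j. Min (range r) \<le> r j" using r(1) by (auto simp: Min_gr_iff)
    then show ?thesis using r(2)
      by (intro exI[of _ "Min (range r)"]) (meson atLeastAtMost_iff order_trans)
  qed
qed

text \<open>Fundamental theorem of calculus for a continuous integrand. The input moves with
  velocity \<open>K\<close> times the state velocity, which is the reason for defining it by this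
  integral.\<close>

lemma C1_path_input_curve:
  assumes "C1_path \<gamma> \<gamma>'" "continuous_on UNIV K"
  shows "C1_path (input_curve K \<gamma> a) (\<lambda>s. K (\<gamma> s) *v \<gamma>' s)"
proof -
  have "continuous_on {0..1} (\<lambda>s. K (\<gamma> s) *v \<gamma>' s)"
    using assms(1) C1_path_continuous[OF assms(1)] unfolding matrix_vector_mult_def
    by (intro continuous_intros continuous_on_compose2[OF assms(2)]) (auto simp: C1_path_def)
  moreover have "((\<lambda>t. integral {0..t} (\<lambda>s. K (\<gamma> s) *v velocity \<gamma> s)) has_vector_derivative
      K (\<gamma> s) *v \<gamma>' s) (at s within {0..1})" if "s \<in> {0..1}" for s
  proof (rule has_vector_derivative_transform[OF that _ integral_has_vector_derivative[OF calculation that]])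
    show "integral {0..t} (\<lambda>s. K (\<gamma> s) *v velocity \<gamma> s) = integral {0..t} (\<lambda>s. K (\<gamma> s) *v \<gamma>' s)"
      if "t \<in> {0..1}" for t
      by (rule integral_cong) (use that in \<open>simp add: C1_path_velocity[OF assms(1)]\<close>)
  qed
  ultimately have "C1_path (\<lambda>t. integral {0..t} (\<lambda>s. K (\<gamma> s) *v velocity \<gamma> s)) (\<lambda>s. K (\<gamma> s) *v \<gamma>' s)"
    by (simp add: C1_path_def)
  from C1_path_add[OF C1_path_const[of a] this] show ?thesis
    by (simp add: input_curve_def[abs_def])
qed

text \<open>An instance of \<open>tightened_constraints\<close>: \<open>q\<close> are the constraint
  values along state and input, \<open>v\<close> is the Riemannian speed. The bound by
  \<open>c j\<close> is asked only on the constraint set, where the maximum defining it is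
  taken.\<close>

lemma closed_loop_curve_in_constraint_set:
  fixes \<gamma> :: "real \<Rightarrow> ('nx::{finite,linorder}) rvec" and h :: "'nh::finite \<Rightarrow> 'nx rvec \<Rightarrow> ('nu::finite) rvec \<Rightarrow> real"
  assumes M: "\<And>x. spd (M x)" "continuous_on UNIV M" and K: "continuous_on UNIV K"
    and h: "\<And>j. cont_diff (\<lambda>(x, u). h j x u)"
    and \<gamma>: "C1_path \<gamma> \<gamma>'" and len: "curve_length M \<gamma> \<le> \<delta>"
    and \<eta>: "\<eta> = input_curve K \<gamma> a"
    and c: "\<And>j. 0 \<le> c j"
      "\<And>j x u. (x, u) \<in> constraint_set h \<Longrightarrow>
         norm (closed_loop_row_deriv (h j) K x u v* matrix_inv (cholesky (M x))) \<le> c j"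
    and tight: "\<And>j. h j (\<gamma> 0) a + c j * \<delta> \<le> 0"
    and degen: "\<And>j. c j = 0 \<Longrightarrow> h j (\<gamma> 0) a = 0 \<Longrightarrow>
      \<exists>N. open N \<and> constraint_set h \<subseteq> N \<and> (\<forall>(x, u)\<in>N. closed_loop_row_deriv (h j) K x u = 0)"
    and s: "s \<in> {0..1}"
  shows "(\<gamma> s, \<eta> s) \<in> constraint_set h"
proof -
  define q where "q j s = h j (\<gamma> s) (\<eta> s)" for j s
  define q' where "q' j s = closed_loop_row_deriv (h j) K (\<gamma> s) (\<eta> s) \<bullet> \<gamma>' s" for j s
  define v where "v s = wnorm (M (\<gamma> s)) (\<gamma>' s)" for s
  have \<eta>': "C1_path \<eta> (\<lambda>s. K (\<gamma> s) *v \<gamma>' s)"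
    unfolding \<eta> using \<gamma> K by (rule C1_path_input_curve)
  have \<zeta>: "C1_path (\<lambda>s. (\<gamma> s, \<eta> s)) (\<lambda>s. (\<gamma>' s, K (\<gamma> s) *v \<gamma>' s))"
    using \<gamma> \<eta>' by (rule C1_path_Pair)
  have \<eta>0: "\<eta> 0 = a" by (simp add: \<eta> input_curve_def)
  have in_Z: "(\<gamma> s, \<eta> s) \<in> constraint_set h \<longleftrightarrow> (\<forall>j. q j s \<le> 0)" for s
    by (simp add: constraint_set_def q_def)
  have "\<forall>s\<in>{0..1}. \<forall>j. q j s \<le> 0"
  proof (rule tightened_constraints[where q' = q' and v = v and c = c and \<delta> = \<delta>])
    show "(q j has_real_derivative q' j s) (at s within {0..1})" if "s \<in> {0..1}" for j s
    proof -
      have "frechet_derivative (\<lambda>(x, u). h j x u) (at (\<gamma> s, \<eta> s)) (\<gamma>' s, K (\<gamma> s) *v \<gamma>' s) = q' j s"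
        unfolding q'_def
        by (rule closed_loop_row_deriv_inner[symmetric]) (rule cont_diff_differentiable[OF h])
      moreover have "(q j has_vector_derivative frechet_derivative (\<lambda>(x, u). h j x u) (at (\<gamma> s, \<eta> s)) (\<gamma>' s, K (\<gamma> s) *v \<gamma>' s))
          (at s within {0..1})"
        using C1_path_compose[OF h[of j] \<zeta>] that by (simp add: C1_path_def q_def[abs_def])
      ultimately show ?thesis
        by (simp only: has_real_derivative_iff_has_vector_derivative)
    qed
    show "continuous_on {0..1} v"
      unfolding v_def using \<gamma> M(2) by (rule continuous_on_speed)
    show "0 \<le> v s" for s unfolding v_def using M(1) by (rule wnorm_nonneg)
    show "q' j s \<le> c j * v s" if "\<forall>i. q i s \<le> 0" for j s
    proof -
      have "q' j s \<le> norm (closed_loop_row_deriv (h j) K (\<gamma> s) (\<eta> s) v* matrix_inv (cholesky (M (\<gamma> s)))) * v s"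
        unfolding q'_def v_def using M(1) by (rule inner_le_wnorm)
      also have "\<dots> \<le> c j * v s"
        by (intro mult_right_mono c(2)) (use that in_Z wnorm_nonneg[OF M(1)] in \<open>auto simp: v_def\<close>)
      finally show ?thesis .
    qed
    show "q' j s = 0" if "v s = 0" for j s
      using that wnorm_pos[OF M(1), of "\<gamma>' s" "\<gamma> s"] by (cases "\<gamma>' s = 0") (auto simp: q'_def v_def)
    show "q j 0 + c j * \<delta> \<le> 0" for j using tight by (simp add: q_def \<eta>0)
    show "integral {0..1} v \<le> \<delta>" using len by (simp add: curve_length_C1[OF \<gamma>] v_def[abs_def])
    show "\<exists>r>s. \<forall>t\<in>{s..r}. t \<le> 1 \<longrightarrow> q' j t = 0"
      if active: "c j = 0" "q j 0 = 0" and s: "0 \<le> s" "s < 1" "\<forall>i. q i s \<le> 0" for j s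
    proof -
      obtain N where N: "open N" "constraint_set h \<subseteq> N"
          "\<forall>(x, u)\<in>N. closed_loop_row_deriv (h j) K x u = 0"
        using degen[of j] active unfolding q_def \<eta>0 by blast
      \<comment> \<open>Openness of \<open>N\<close> extends membership at \<open>s\<close> to
        parameters shortly after \<open>s\<close>, where the curve is not yet known to lie in the
        constraint set.\<close>
      have "(\<gamma> s, \<eta> s) \<in> N" using N(2) in_Z s(3) by blast
      moreover have "((\<lambda>s. (\<gamma> s, \<eta> s)) \<longlongrightarrow> (\<gamma> s, \<eta> s)) (at s within {0..1})"
        using C1_path_continuous[OF \<zeta>] s by (auto simp: continuous_on_def)
      ultimately have "eventually (\<lambda>t. (\<gamma> t, \<eta> t) \<in> N) (at s within {0..1})"
        using N(1) topological_tendstoD by blast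
      then obtain d where d: "d > 0" "\<forall>t\<in>{0..1}. t \<noteq> s \<and> dist t s < d \<longrightarrow> (\<gamma> t, \<eta> t) \<in> N"
        unfolding eventually_at by blast
      have "q' j t = 0" if "t \<in> {s..s + d / 2}" "t \<le> 1" for t
      proof -
        have "(\<gamma> t, \<eta> t) \<in> N"
          using d that \<open>(\<gamma> s, \<eta> s) \<in> N\<close> \<open>0 \<le> s\<close> by (cases "t = s") (auto simp: dist_real_def)
        then show ?thesis using N(3) by (auto simp: q'_def)
      qed
      then show ?thesis using d(1) by (intro exI[of _ "s + d / 2"]) auto
    qed
  qed (use c in auto)
  then show ?thesis using s in_Z by blast
qed

section \<open>Contraction under disturbances\<close>

lemma sum_UNIV_Plus:
  "(\<Sum>i\<in>(UNIV :: ('a::finite + 'b::finite) set). f i) = (\<Sum>a\<in>UNIV. f (Inl a)) + (\<Sum>b\<in>UNIV. f (Inr b))"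
  using sum.Plus[of UNIV UNIV f] by (simp add: UNIV_Plus_UNIV o_def)

lemma hcat_mult_vcat: "hcat P Q *v vcat a b = P *v a + Q *v b"
  by (simp add: vec_eq_iff matrix_vector_mult_def hcat_def vcat_def sum_UNIV_Plus)

lemma row_kron_mult_vkron: "row_kron v P *v vkron p r = (v \<bullet> p) *\<^sub>R (P *v r)"
proof -
  have "(\<Sum>z\<in>UNIV. v $ fst z * P $ i $ snd z * (p $ fst z * r $ snd z))
      = (\<Sum>a\<in>UNIV. v $ a * p $ a) * (\<Sum>b\<in>UNIV. P $ i $ b * r $ b)" for i
    by (simp add: UNIV_Times_UNIV[symmetric] sum_product sum.cartesian_product case_prod_unfold mult_ac
        del: UNIV_Times_UNIV)
  then show ?thesis
    by (simp add: vec_eq_iff matrix_vector_mult_def row_kron_def vkron_def inner_vec_def)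
qed

text \<open>By the mixed-product rule, and because both blocks share the factor \<open>r\<close>,
  the disturbance acts as the vector \<open>r\<close> scaled by a number that carries all dependence
  on state and input.\<close>

lemma E_mat_mult:
  "E_mat \<phi> c\<^sub>x c\<^sub>u x u *v vcat (vkron p r) (vkron q r) = (c\<^sub>x * (lift_hat \<phi> x \<bullet> p) + c\<^sub>u * (u \<bullet> q)) *\<^sub>R r"
  by (simp add: E_mat_def hcat_mult_vcat row_kron_mult_vkron scaleR_matrix_vector_assoc[symmetric]
      scaleR_add_left)

lemma vcat_scaleR: "c *\<^sub>R vcat a b = vcat (c *\<^sub>R a) (c *\<^sub>R b)"
  by (simp add: vec_eq_iff vcat_def split: sum.split)

lemma vkron_scaleR_right: "vkron a (c *\<^sub>R b) = c *\<^sub>R vkron a b"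
  by (simp add: vec_eq_iff vkron_def)

text \<open>The scalar is absorbed by the common factor \<open>r\<close>. This allows a disturbance
  to be switched on gradually without leaving the admissible set.\<close>

lemma disturbance_set_scaleR:
  assumes "w \<in> disturbance_set" "0 \<le> t" "t \<le> 1"
  shows "t *\<^sub>R w \<in> disturbance_set"
proof -
  obtain p q r where w: "w = vcat (vkron p r) (vkron q r)" "norm p \<le> 1" "norm q \<le> 1" "norm r \<le> 1"
    using assms(1) by (auto simp: disturbance_set_def)
  have "t *\<^sub>R w = vcat (vkron p (t *\<^sub>R r)) (vkron q (t *\<^sub>R r))"
    by (simp add: w vcat_scaleR vkron_scaleR_right)
  moreover have "norm (t *\<^sub>R r) \<le> 1" using w(4) assms(2,3) by (simp add: mult_le_one)
  ultimately show ?thesis using w(2,3) by (force simp: disturbance_set_def)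
qed

text \<open>Cauchy-Schwarz in each block. The point (x, u) is arbitrary, so a disturbance selected
  at the true state can be measured at the nominal one.\<close>

lemma norm_E_mat_mult_le:
  assumes "w \<in> disturbance_set" "0 \<le> c\<^sub>x" "0 \<le> c\<^sub>u"
  shows "norm (E_mat \<phi> c\<^sub>x c\<^sub>u x u *v w) \<le> c\<^sub>x * norm (lift_hat \<phi> x) + c\<^sub>u * norm u"
proof -
  obtain p q r where w: "w = vcat (vkron p r) (vkron q r)" "norm p \<le> 1" "norm q \<le> 1" "norm r \<le> 1"
    using assms(1) by (auto simp: disturbance_set_def)
  have ip: "\<bar>a \<bullet> b\<bar> \<le> norm a" if "norm b \<le> 1" for a b :: "real^'k"
    using Cauchy_Schwarz_ineq2[of a b] mult_left_le[OF that, of "norm a"] by simp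
  let ?s = "c\<^sub>x * (lift_hat \<phi> x \<bullet> p) + c\<^sub>u * (u \<bullet> q)"
  have "\<bar>?s\<bar> \<le> c\<^sub>x * \<bar>lift_hat \<phi> x \<bullet> p\<bar> + c\<^sub>u * \<bar>u \<bullet> q\<bar>"
    using assms(2,3) abs_triangle_ineq[of "c\<^sub>x * (lift_hat \<phi> x \<bullet> p)" "c\<^sub>u * (u \<bullet> q)"] by (simp add: abs_mult)
  also have "\<dots> \<le> c\<^sub>x * norm (lift_hat \<phi> x) + c\<^sub>u * norm u"
    using assms(2,3) w by (intro add_mono mult_left_mono ip) auto
  finally have "\<bar>?s\<bar> \<le> c\<^sub>x * norm (lift_hat \<phi> x) + c\<^sub>u * norm u" .
  moreover have "\<bar>?s\<bar> * norm r \<le> \<bar>?s\<bar>" using w(4) by (simp add: mult_left_le)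
  ultimately show ?thesis by (simp add: w(1) E_mat_mult)
qed

text \<open>Aligning \<open>p\<close> and \<open>q\<close> with the lifted state and the input makes
  the scalar in \<open>E_mat_mult\<close> equal to the full bound; \<open>r\<close> is then
  \<open>e\<close> divided by it.\<close>

lemma E_mat_covers:
  assumes "norm e \<le> c\<^sub>x * norm (lift_hat \<phi> x) + c\<^sub>u * norm u"
  obtains w where "w \<in> disturbance_set" "E_mat \<phi> c\<^sub>x c\<^sub>u x u *v w = e"
proof -
  define \<beta> where "\<beta> = c\<^sub>x * norm (lift_hat \<phi> x) + c\<^sub>u * norm u"
  define p where "p = sgn (lift_hat \<phi> x)"
  define q where "q = sgn u"
  define r where "r = inverse \<beta> *\<^sub>R e"
  have sgn: "a \<bullet> sgn a = norm a" for a :: "real^'k"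
    by (cases "a = 0") (simp_all add: sgn_div_norm dot_square_norm power2_eq_square)
  have e: "norm e \<le> \<beta>" using assms by (simp add: \<beta>_def)
  \<comment> \<open>If \<open>\<beta> = 0\<close>, then \<open>e = 0\<close>, and
    \<open>inverse 0 = 0\<close> gives \<open>r = 0\<close>.\<close>
  have r: "norm r \<le> 1" "\<beta> *\<^sub>R r = e"
    using e order_trans[OF norm_ge_zero e] by (cases "\<beta> = 0"; simp add: r_def field_simps)+
  have "vcat (vkron p r) (vkron q r) \<in> disturbance_set"
    using r by (force simp: disturbance_set_def p_def q_def norm_sgn)
  moreover have "E_mat \<phi> c\<^sub>x c\<^sub>u x u *v vcat (vkron p r) (vkron q r) = e"
    using r(2) by (simp add: E_mat_mult p_def q_def sgn \<beta>_def)
  ultimately show ?thesis using that by blast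
qed

section \<open>From the error bound to an admissible disturbance\<close>

lemma hcat_mult_lift_hat: "hcat (mat 1) 0 *v lift_hat \<phi> y = y"
  by (simp add: lift_hat_def hcat_mult_vcat)

lemma norm_hcat_mat_1_le:
  fixes z :: "real^('m::finite + 'n::finite)"
  shows "norm (hcat (mat 1) 0 *v z) \<le> norm z"
proof -
  have z: "z = vcat (\<chi> i. z $ Inl i) (\<chi> i. z $ Inr i)"
    by (simp add: vec_eq_iff vcat_def split: sum.split)
  have "hcat (mat 1) 0 *v z = (\<chi> i. z $ Inl i)"
    by (subst z) (simp add: hcat_mult_vcat)
  then show ?thesis
    by (simp add: norm_eq_sqrt_inner inner_vec_def sum_UNIV_Plus sum_nonneg)
qed

text \<open>The lift contains the state as its first block, so the state prediction error is a
  projection of the lifted model error and inherits its bound; \<open>E_mat_covers\<close> then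
  realises it.\<close>

lemma PEB_disturbance:
  assumes "PEB X U F \<phi> A b B c\<^sub>x c\<^sub>u" "x \<in> X" "u \<in> U"
  obtains w where "w \<in> disturbance_set" "F x u = f_w \<phi> A b B c\<^sub>x c\<^sub>u x u w"
proof -
  have "F x u - F_hat \<phi> A b B x u = hcat (mat 1) 0 *v model_error F \<phi> A b B x u"
    by (simp add: model_error_def F_hat_def matrix_vector_mult_diff_distrib hcat_mult_lift_hat)
  then have "norm (F x u - F_hat \<phi> A b B x u) \<le> c\<^sub>x * norm (lift_hat \<phi> x) + c\<^sub>u * norm u"
    using norm_hcat_mat_1_le[of "model_error F \<phi> A b B x u"] assms by (fastforce simp: PEB_def)
  then obtain w where w: "w \<in> disturbance_set" "E_mat \<phi> c\<^sub>x c\<^sub>u x u *v w = F x u - F_hat \<phi> A b B x u"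
    by (rule E_mat_covers)
  show ?thesis
    by (rule that[OF w(1)]) (simp add: f_w_def w(2))
qed

text \<open>The lift is a linear embedding plus the functions \<open>\<phi> l\<close> times basis
  vectors, a form to which the closure rules apply.\<close>

lemma cont_diff_lift_hat:
  fixes \<phi> :: "'r::finite \<Rightarrow> real^'n \<Rightarrow> real"
  assumes "\<And>l. cont_diff (\<phi> l)"
  shows "cont_diff (lift_hat \<phi>)"
proof -
  have "bounded_linear (\<lambda>x :: real^'n. vcat x (0 :: real^'r))"
    unfolding linear_conv_bounded_linear[symmetric]
    by (rule linearI) (simp_all add: vec_eq_iff vcat_def split: sum.split)
  then have "cont_diff (\<lambda>x. vcat x 0 + (\<Sum>l\<in>UNIV. \<phi> l x *\<^sub>R axis (Inr l) 1))"
    by (intro cont_diff_add cont_diff_sum cont_diff_scaleR cont_diff_const assms cont_diff_bounded_linear)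
  moreover have "lift_hat \<phi> x = vcat x 0 + (\<Sum>l\<in>UNIV. \<phi> l x *\<^sub>R axis (Inr l) 1)"
    (is "_ = ?rhs x") for x
  proof -
    have coord: "(\<Sum>l\<in>UNIV. \<phi> l x * axis (Inr l) 1 $ i) = (case i of Inl a \<Rightarrow> 0 | Inr l \<Rightarrow> \<phi> l x)" for i
      by (cases i) (simp_all add: axis_def if_distrib[of "\<lambda>z. _ * z"] cong: if_cong)
    show ?thesis
      by (simp add: vec_eq_iff lift_hat_def vcat_def coord split: sum.split)
  qed
  then have "lift_hat \<phi> = ?rhs" by (rule ext)
  ultimately show ?thesis by (simp only:)
qed

lemma cont_diff_f_w:
  assumes "\<And>l. cont_diff (\<phi> l)" "w \<in> disturbance_set"
  shows "cont_diff (\<lambda>(x, u). f_w \<phi> A b B c\<^sub>x c\<^sub>u x u w)"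
proof -
  obtain p q r where w: "w = vcat (vkron p r) (vkron q r)"
    using assms(2) by (auto simp: disturbance_set_def)
  note lin = cont_diff_bounded_linear[OF bounded_linear_fst] cont_diff_bounded_linear[OF bounded_linear_snd]
  have \<Phi>: "cont_diff (\<lambda>z. lift_hat \<phi> (fst z))"
    by (rule cont_diff_compose[OF cont_diff_lift_hat[OF assms(1)] lin(1)])
  \<comment> \<open>For a fixed disturbance, \<open>E_mat_mult\<close> turns the matrix term into
    inner products times the constant vector \<open>r\<close>, so no matrix-valued map has to be
    differentiated.\<close>
  have "cont_diff (\<lambda>z. hcat (mat 1) 0 *v
      (A *v lift_hat \<phi> (fst z) + from_cols b *v snd z
        + (\<Sum>i\<in>UNIV. (snd z $ i) *\<^sub>R ((B i - A) *v lift_hat \<phi> (fst z))))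
      + (c\<^sub>x *\<^sub>R (lift_hat \<phi> (fst z) \<bullet> p) + c\<^sub>u *\<^sub>R (snd z \<bullet> q)) *\<^sub>R r)"
    by (intro cont_diff_add cont_diff_sum cont_diff_scaleR cont_diff_const \<Phi> lin
        cont_diff_linear_compose[OF matrix_vector_mul_bounded_linear]
        cont_diff_linear_compose[OF bounded_linear_vec_nth]
        cont_diff_linear_compose[OF bounded_linear_inner_left])
  then show ?thesis
    by (simp add: f_w_def F_hat_def lifted_model_def w E_mat_mult case_prod_unfold)
qed

text \<open>The disturbance is first switched on at the nominal point, moving along a straight line, and
  the contracting map with this fixed disturbance is then applied to the curve.\<close>

lemma riem_dist_step:
  fixes M :: "('nx::{finite,linorder}) rvec \<Rightarrow> ('nx, 'nx) rmat" and K :: "'nx rvec \<Rightarrow> ('nu::finite, 'nx) rmat"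
    and \<phi> :: "'nr::finite \<Rightarrow> 'nx rvec \<Rightarrow> real"
  assumes rccm: "RCCM Z disturbance_set (f_w \<phi> A b B c\<^sub>x c\<^sub>u) M K \<rho>\<^sub>c \<alpha>\<^sub>1 \<alpha>\<^sub>2"
    and phi: "\<And>l. cont_diff (\<phi> l)" and cxu: "0 \<le> c\<^sub>x" "0 \<le> c\<^sub>u"
    and w: "w \<in> disturbance_set"
    and \<gamma>: "C1_path \<gamma> \<gamma>'" and \<eta>: "C1_path \<eta> (\<lambda>s. K (\<gamma> s) *v \<gamma>' s)"
    and Z: "\<And>s. s \<in> {0..1} \<Longrightarrow> (\<gamma> s, \<eta> s) \<in> Z"
  shows "riem_dist M (f_w \<phi> A b B c\<^sub>x c\<^sub>u (\<gamma> 1) (\<eta> 1) w) (F_hat \<phi> A b B (\<gamma> 0) (\<eta> 0))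
    \<le> sqrt (1 - \<rho>\<^sub>c) * curve_length M \<gamma>
      + sqrt \<alpha>\<^sub>2 * (c\<^sub>x * norm (lift_hat \<phi> (\<gamma> 0)) + c\<^sub>u * norm (\<eta> 0))"
proof -
  let ?f = "f_w \<phi> A b B c\<^sub>x c\<^sub>u"
  let ?J = "closed_loop_jacobian ?f K"
  let ?\<beta> = "c\<^sub>x * norm (lift_hat \<phi> (\<gamma> 0)) + c\<^sub>u * norm (\<eta> 0)"
  have spd: "\<And>x. spd (M x)" and M: "continuous_on UNIV M"
    and \<rho>: "\<rho>\<^sub>c < 1" and \<alpha>: "0 < \<alpha>\<^sub>2"
    using rccm by (auto simp: RCCM_def intro: cont_diff_continuous_on)
  have contr: "transpose (?J x u w) ** M (?f x u w) ** ?J x u w \<preceq>\<^sub>L (1 - \<rho>\<^sub>c) *\<^sub>R M x"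
    and bound: "M (?f x u w) \<preceq>\<^sub>L \<alpha>\<^sub>2 *\<^sub>R mat 1"
    if "(x, u) \<in> Z" "w \<in> disturbance_set" for x u w
    using rccm that unfolding RCCM_def Let_def by blast+
  \<comment> \<open>The offset that the same \<open>w\<close> causes at the starting point of the
    curve, which is the nominal point in the application.\<close>
  define e where "e = E_mat \<phi> c\<^sub>x c\<^sub>u (\<gamma> 0) (\<eta> 0) *v w"
  define line where "line s = F_hat \<phi> A b B (\<gamma> 0) (\<eta> 0) + s *\<^sub>R e" for s
  have line: "C1_path line (\<lambda>_. e)"
    unfolding C1_path_def line_def by (auto intro!: derivative_eq_intros continuous_intros)
  \<comment> \<open>For parameters in [0, 1] this exhibits the points of the segment as successors
    under the admissible disturbances \<open>s *\<^sub>R w\<close>, so the upper bound on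
    \<open>M\<close> applies along it.\<close>
  have line_f_w: "line s = ?f (\<gamma> 0) (\<eta> 0) (s *\<^sub>R w)" for s
    by (simp add: line_def e_def f_w_def matrix_vector_mult_scaleR)
  have line_speed: "wnorm (M (line s)) e \<le> sqrt \<alpha>\<^sub>2 * ?\<beta>" if "s \<in> {0..1}" for s
  proof -
    have "wnorm (M (line s)) e \<le> sqrt \<alpha>\<^sub>2 * norm e"
      unfolding line_f_w using that \<alpha>
      by (intro wnorm_le_norm bound Z disturbance_set_scaleR w) auto
    also have "\<dots> \<le> sqrt \<alpha>\<^sub>2 * ?\<beta>"
      unfolding e_def using \<alpha> by (intro mult_left_mono norm_E_mat_mult_le w cxu) auto
    finally show ?thesis .
  qed
  have "integral {0..1} (\<lambda>s. wnorm (M (line s)) e) \<le> integral {0..1} (\<lambda>s::real. sqrt \<alpha>\<^sub>2 * ?\<beta>)"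
    by (intro integral_le integrable_continuous_interval continuous_on_speed[OF line M] line_speed
        continuous_intros)
  then have line_len: "curve_length M line \<le> sqrt \<alpha>\<^sub>2 * ?\<beta>"
    by (simp add: curve_length_C1[OF line])
  define \<psi> where "\<psi> s = ?f (\<gamma> s) (\<eta> s) w" for s
  define \<psi>' where "\<psi>' s = ?J (\<gamma> s) (\<eta> s) w *v \<gamma>' s" for s
  have f_w: "cont_diff (\<lambda>(x, u). ?f x u w)" using phi w by (rule cont_diff_f_w)
  have \<psi>: "C1_path \<psi> \<psi>'"
    using C1_path_compose[OF f_w C1_path_Pair[OF \<gamma> \<eta>]]
    by (simp add: \<psi>_def[abs_def] \<psi>'_def[abs_def]
        closed_loop_jacobian_mult[where f = ?f, OF cont_diff_differentiable[OF f_w]])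
  have "integral {0..1} (\<lambda>s. wnorm (M (\<psi> s)) (\<psi>' s))
      \<le> integral {0..1} (\<lambda>s. sqrt (1 - \<rho>\<^sub>c) * wnorm (M (\<gamma> s)) (\<gamma>' s))"
  proof (intro integral_le integrable_continuous_interval continuous_on_mult continuous_on_const
      continuous_on_speed[OF \<psi> M] continuous_on_speed[OF \<gamma> M])
    show "wnorm (M (\<psi> s)) (\<psi>' s) \<le> sqrt (1 - \<rho>\<^sub>c) * wnorm (M (\<gamma> s)) (\<gamma>' s)" if "s \<in> {0..1}" for s
      unfolding \<psi>_def \<psi>'_def by (rule wnorm_contraction[OF contr[OF Z[OF that] w]]) (use \<rho> in simp)
  qed
  then have \<psi>_len: "curve_length M \<psi> \<le> sqrt (1 - \<rho>\<^sub>c) * curve_length M \<gamma>"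
    by (simp add: curve_length_C1[OF \<psi>] curve_length_C1[OF \<gamma>])
  have "line \<in> curves (F_hat \<phi> A b B (\<gamma> 0) (\<eta> 0)) (\<psi> 0)"
    using C1_path_curves[OF line] line_f_w[of 1] by (simp add: \<psi>_def) (simp add: line_def)
  then obtain \<zeta> where \<zeta>: "\<zeta> \<in> curves (F_hat \<phi> A b B (\<gamma> 0) (\<eta> 0)) (\<psi> 1)"
      "curve_length M \<zeta> = curve_length M line + curve_length M \<psi>"
    using curves_concat[OF spd M _ C1_path_curves[OF \<psi>]] by blast
  have "riem_dist M (\<psi> 1) (F_hat \<phi> A b B (\<gamma> 0) (\<eta> 0)) \<le> curve_length M \<zeta>"
    using spd \<zeta>(1) by (rule riem_dist_le)
  then show ?thesis using \<zeta>(2) line_len \<psi>_len by (simp add: \<psi>_def)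
qed

theorem theorem1:
  fixes f :: "('nx::{finite,linorder}) rvec \<Rightarrow> 'nx rvec"
    and g :: "'nx rvec \<Rightarrow> ('nx, 'nu::finite) rmat"
    and T\<^sub>s :: real
    and F :: "'nx rvec \<Rightarrow> 'nu rvec \<Rightarrow> 'nx rvec"
    and X :: "'nx rvec set" and U :: "'nu rvec set"
    and Z :: "('nx rvec \<times> 'nu rvec) set"
    and h :: "'nh::finite \<Rightarrow> 'nx rvec \<Rightarrow> 'nu rvec \<Rightarrow> real"
    and \<phi> :: "'nr::finite \<Rightarrow> 'nx rvec \<Rightarrow> real"
    and x_dat y_dat :: "'nu rvec \<Rightarrow> 'd::finite \<Rightarrow> 'nx rvec"
    and A :: "('nx + 'nr, 'nx + 'nr) rmat"
    and b :: "'nu \<Rightarrow> ('nx + 'nr) rvec"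
    and B :: "'nu \<Rightarrow> ('nx + 'nr, 'nx + 'nr) rmat"
    and c\<^sub>x c\<^sub>u \<rho>\<^sub>c \<alpha>\<^sub>1 \<alpha>\<^sub>2 :: real
    and M :: "'nx rvec \<Rightarrow> ('nx, 'nx) rmat"
    and K :: "'nx rvec \<Rightarrow> ('nu, 'nx) rmat"
    and geo :: "'nx rvec \<Rightarrow> 'nx rvec \<Rightarrow> real \<Rightarrow> 'nx rvec"
    and c :: "'nh \<Rightarrow> real"
    and x xb :: "nat \<Rightarrow> 'nx rvec" and ub :: "nat \<Rightarrow> 'nu rvec" and \<delta> :: "nat \<Rightarrow> real"
  assumes F: "F = flow f g T\<^sub>s" and Z_def: "Z = constraint_set h"
    and X: "compact X" and U: "compact U" and U_basis: "\<forall>i. axis i 1 \<in> U"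
    and f0: "f 0 = 0" and Ts: "0 < T\<^sub>s"
    and Z: "Z \<subseteq> X \<times> U" "compact Z"
    and h: "\<forall>j. cont_diff (\<lambda>(x, u). h j x u)" "\<forall>j. h j 0 0 < 0"
    and phi: "\<forall>l. cont_diff (\<phi> l)" "\<forall>l. \<phi> l 0 = 0"
    and data: "\<forall>v\<in>insert 0 (range (\<lambda>i. axis i 1)). \<forall>j. y_dat v j = F (x_dat v j) v"
    and fit_A: "least_squares (from_cols (\<lambda>j. lift_hat \<phi> (y_dat 0 j)))
                              (from_cols (\<lambda>j. lift_hat \<phi> (x_dat 0 j))) A"
    and fit_B: "\<forall>i. least_squares (from_cols (\<lambda>j. lift_hat \<phi> (y_dat (axis i 1) j)))
                                  (from_cols (\<lambda>j. lift_one \<phi> (x_dat (axis i 1) j)))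
                                  (hcat (columnvector (b i)) (B i))"
    and peb: "PEB X U F \<phi> A b B c\<^sub>x c\<^sub>u"
    and rccm: "RCCM Z disturbance_set (f_w \<phi> A b B c\<^sub>x c\<^sub>u) M K \<rho>\<^sub>c \<alpha>\<^sub>1 \<alpha>\<^sub>2"
    and geo: "\<forall>z\<^sub>0 z\<^sub>1. geodesic M z\<^sub>0 z\<^sub>1 (geo z\<^sub>0 z\<^sub>1)"
    and c: "\<forall>j. is_max (c j)
              ((\<lambda>(x, u). norm (closed_loop_row_deriv (h j) K x u v* matrix_inv (cholesky (M x)))) ` Z)"
    and tight: "\<forall>k j. h j (xb k) (ub k) + c j * \<delta> k \<le> 0"
    and nominal: "\<forall>k. xb (Suc k) = F_hat \<phi> A b B (xb k) (ub k)"
    and init: "riem_dist M (x 0) (xb 0) \<le> \<delta> 0"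
    and delta: "\<forall>k. \<delta> (Suc k) = sqrt (1 - \<rho>\<^sub>c) * \<delta> k
                  + sqrt \<alpha>\<^sub>2 * (c\<^sub>x * norm (lift_hat \<phi> (xb k)) + c\<^sub>u * norm (ub k))"
    \<comment> \<open>regularity, only relevant for a constraint whose tightening constant vanishes and that is
        active at the nominal point: its closed-loop derivative, zero on Z, is zero around Z; without
        this the claim fails, e.g. if the nominal point is isolated in Z\<close>
    and degenerate: "\<forall>j k. c j = 0 \<and> h j (xb k) (ub k) = 0 \<longrightarrow>
          (\<exists>N. open N \<and> Z \<subseteq> N \<and> (\<forall>(x, u)\<in>N. closed_loop_row_deriv (h j) K x u = 0))"
    and true_traj: "\<forall>k. x (Suc k) = F (x k) (feedback K geo (x k) (xb k) (ub k))"
  shows "\<forall>k. riem_dist M (x k) (xb k) \<le> \<delta> k \<and>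
             (x k, feedback K geo (x k) (xb k) (ub k)) \<in> Z"
proof -
  have spd: "\<And>x. spd (M x)" and M: "continuous_on UNIV M" and K: "continuous_on UNIV K"
    using rccm by (auto simp: RCCM_def intro: cont_diff_continuous_on)
  have cxu: "0 \<le> c\<^sub>x" "0 \<le> c\<^sub>u" using peb by (auto simp: PEB_def)
  have c_bound: "norm (closed_loop_row_deriv (h j) K y v v* matrix_inv (cholesky (M y))) \<le> c j"
    if "(y, v) \<in> Z" for j y v
    using c that unfolding is_max_def by force
  \<comment> \<open>The maximum is attained, hence is itself a norm.\<close>
  have c_nonneg: "0 \<le> c j" for j
    using c[rule_format, of j] norm_ge_zero unfolding is_max_def by (auto simp: case_prod_unfold)
  define u where "u k = feedback K geo (x k) (xb k) (ub k)" for k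
  define \<gamma> where "\<gamma> k = geo (xb k) (x k)" for k
  define \<eta> where "\<eta> k = input_curve K (\<gamma> k) (ub k)" for k
  have mem: "\<gamma> k \<in> curves (xb k) (x k)" for k
    using geo by (simp add: geodesic_def \<gamma>_def)
  have ends: "\<gamma> k 0 = xb k" "\<gamma> k 1 = x k" "\<eta> k 0 = ub k" "\<eta> k 1 = u k" for k
    using mem[of k] by (auto simp: curves_def \<eta>_def u_def feedback_def \<gamma>_def input_curve_def)
  have path: "C1_path (\<gamma> k) (velocity (\<gamma> k))" for k
    using mem by (rule curves_C1_path)
  have len: "riem_dist M (x k) (xb k) = curve_length M (\<gamma> k)" for k
    unfolding \<gamma>_def using geo by (intro riem_dist_geodesic) blast
  \<comment> \<open>Stated conditionally, because the induction for the distance bound needs it at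
    \<open>k\<close> in order to reach \<open>Suc k\<close>.\<close>
  have tube: "(\<gamma> k s, \<eta> k s) \<in> Z" if "riem_dist M (x k) (xb k) \<le> \<delta> k" "s \<in> {0..1}" for k s
    unfolding Z_def
  proof (rule closed_loop_curve_in_constraint_set[OF spd M K _ path _ \<eta>_def c_nonneg _ _ _ that(2)])
    show "curve_length M (\<gamma> k) \<le> \<delta> k" using that(1) len by simp
    show "h j (\<gamma> k 0) (ub k) + c j * \<delta> k \<le> 0" for j using tight ends by simp
    show "\<exists>N. open N \<and> constraint_set h \<subseteq> N \<and> (\<forall>(x, u)\<in>N. closed_loop_row_deriv (h j) K x u = 0)"
      if "c j = 0" "h j (\<gamma> k 0) (ub k) = 0" for j
      using degenerate that unfolding ends Z_def by blast
  qed (use h c_bound Z_def in auto)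
  have dist: "riem_dist M (x k) (xb k) \<le> \<delta> k" for k
  proof (induction k)
    case 0
    show ?case by (rule init)
  next
    case (Suc k)
    \<comment> \<open>At parameter 1 the curve is the true state with the applied input. Since
      \<open>Z \<subseteq> X \<times> U\<close>, the error bound holds there and supplies
      \<open>w\<close>.\<close>
    have "(x k, u k) \<in> Z" using tube[OF Suc, of 1] ends by simp
    then obtain w where w: "w \<in> disturbance_set" "F (x k) (u k) = f_w \<phi> A b B c\<^sub>x c\<^sub>u (x k) (u k) w"
      using PEB_disturbance[OF peb] Z(1) by blast
    have \<eta>: "C1_path (\<eta> k) (\<lambda>s. K (\<gamma> k s) *v velocity (\<gamma> k) s)"
      unfolding \<eta>_def using path K by (rule C1_path_input_curve)
    have "riem_dist M (f_w \<phi> A b B c\<^sub>x c\<^sub>u (\<gamma> k 1) (\<eta> k 1) w) (F_hat \<phi> A b B (\<gamma> k 0) (\<eta> k 0))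
        \<le> sqrt (1 - \<rho>\<^sub>c) * curve_length M (\<gamma> k)
          + sqrt \<alpha>\<^sub>2 * (c\<^sub>x * norm (lift_hat \<phi> (\<gamma> k 0)) + c\<^sub>u * norm (\<eta> k 0))"
      using rccm phi(1) cxu w(1) path \<eta> tube[OF Suc] by (intro riem_dist_step) auto
    also have "\<dots> \<le> \<delta> (Suc k)"
      using Suc rccm len[of k] by (simp add: ends delta RCCM_def mult_left_mono)
    finally show ?case using true_traj nominal w(2) by (simp add: ends u_def)
  qed
  have "(x k, u k) \<in> Z" for k
    using tube[OF dist, of 1 k] ends by simp
  then show ?thesis using dist by (simp add: u_def)
qed

end
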